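(* Let $n\ge 3$ be an integer and let $m$ be a rational integer with $m\neq 0,\pm1$ such that $F(x)=x^n-m\in\mathbb{Z}[x]$ is irreducible over $\mathbb{Q}$. Let $K=\mathbb{Q}(\alpha)$ where $\alpha$ is a root of $F(x)$. Assume that $n=u\cdot p^r$, where $u$ is a positive integer, $r$ is a nonnegative integer, and $p$ is an odd prime not dividing $u\cdot m$. Let $\nu=\nu_p(m^{p-1}-1)$. If $$\min\{r+1,\nu\}\cdot N_p(d,u,m)>N_p(d)$$ for some positive integer $d$, then $K$ is not monogenic.
   Context: For a prime $p$, $\nu_p$ denotes the $p$-adic valuation and $\mathbb{F}_p$ the field with $p$ elements. For a positive integer $d$, $N_p(d)$ is the number of monic irreducible polynomials of degree $d$ in $\mathbb{F}_p[x]$, and for positive integers $d,u$, $N_p(d,u,m)$ is the number of distinct monic irreducible factors of degree $d$ of the polynomial $x^u-\overline{m}$ in $\mathbb{F}_p[x]$. A number field $K$ with ring of integers $\mathbb{Z}_K$ is monogenic if there is $\theta\in\mathbb{Z}_K$ such that $\{1,\theta,\dots,\theta^{[K:\mathbb{Q}]-1}\}$ is a $\mathbb{Z}$-basis of $\mathbb{Z}_K$. *)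

theory Defs
  imports "HOL-Computational_Algebra.Computational_Algebra" "Berlekamp_Zassenhaus.Finite_Field"
begin

definition num_field :: "complex \<Rightarrow> complex set" where
  "num_field \<alpha> = {poly (map_poly of_rat q) \<alpha> | q :: rat poly. True}"

definition ring_of_ints :: "complex set \<Rightarrow> complex set" where
  "ring_of_ints K = {x \<in> K. algebraic_int x}"

text \<open>Monogenic: some theta in Z_K whose powers 1, theta, ..., theta^(k-1) form a
  Z-basis of Z_K (every element has a unique integer coordinate vector).  Such a
  k is necessarily the degree [K:Q].\<close>
definition monogenic :: "complex set \<Rightarrow> bool" where
  "monogenic K \<longleftrightarrow> (\<exists>\<theta>\<in>ring_of_ints K. \<exists>k::nat.
     \<forall>x\<in>ring_of_ints K. \<exists>!c::nat \<Rightarrow> int. (\<forall>i\<ge>k. c i = 0) \<and>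
        x = (\<Sum>i<k. of_int (c i) * \<theta> ^ i))"

text \<open>N_p(d): number of monic irreducible polynomials of degree d over F_p
  (F_p is the type 'p mod_ring with CARD('p) = p).\<close>
definition N_irr :: "'p::prime_card itself \<Rightarrow> nat \<Rightarrow> nat" where
  "N_irr _ d = card {f :: 'p mod_ring poly. monic f \<and> irreducible f \<and> degree f = d}"

definition N_fac :: "'p::prime_card itself \<Rightarrow> nat \<Rightarrow> nat \<Rightarrow> int \<Rightarrow> nat" where
  "N_fac _ d u m = card {f :: 'p mod_ring poly. monic f \<and> irreducible f \<and> degree f = d \<and>
       f dvd (Polynomial.monom 1 u - [:of_int m:])}"

end

theory Submission
  imports Defs "Jordan_Normal_Form.Char_Poly" "HOL-Computational_Algebra.Field_as_Ring"
begin

text \<open>Put $s = \min(r, \nu - 1)$. Since $p$ is odd, $m$ is modulo any power $p^N$ the $p^s$-th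
  power of an integer $m_0$, so $x^n - m$ is congruent modulo $p^N$ to
  $Z^{p^s} - m_0^{p^s} = \prod_{i \le s} G_i$ with $Z = x^{u p^{r-s}}$, where $G_i$ is the homogenised
  $p^i$-th cyclotomic polynomial in $(Z, m_0)$. For an irreducible factor $\phi$ of $x^u - m$ over
  $F_p$ the localisation of $\mathbb{Z}[x]/(G_i)$ at $(p, \phi)$ is a discrete valuation ring with
  residue field $F_p[x]/(\phi)$, because $G_i \notin (p, \phi)^2$. Valuation rings are integrally
  closed and $N$ may be taken large, so a generator $\theta$ of the ring of integers has a residue in
  each of these $s + 1$ fields; its minimal polynomial over $F_p$ has degree $\deg \phi$, since the
  root $\alpha$ is a polynomial in $\theta$. The algebraic integers $(\prod_{l > j} G_l)(\alpha) / p^{s-j}$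
  are polynomials in $\theta$ as well and separate different $i$, so distinct pairs $(i, \phi)$ give
  distinct minimal polynomials.\<close>

text \<open>The factorisation into the \<open>G i\<close> holds only modulo \<open>p ^ N\<close>:
  the polynomial is irreducible over Q, so in general Z[x]/(G_i) is not a quotient of Z[alpha].
  Instead of passing to the completion at p, every relation satisfied by alpha is read in Z[x]/(G_i)
  up to an error of valuation at least \<open>e * N\<close>, where \<open>e\<close> is the valuation
  of p. The denominator of theta and the length of its power basis are fixed before N is chosen, so
  such an error cannot reach the residues. The value of s is forced from two sides. Divisibility of
  m^(p-1) - 1 by p^(s+1) gives p^s-th roots of m modulo every p^N. Its maximality makes G_0 regular:
  for s = r the binomial x^u - m_0 is separable modulo p, and for t = r - s > 0 the number m^(p^t) -
  m_0 is divisible by p exactly once. Since s + 1 = min(r + 1, nu), the number of pairs (i, phi) is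
  the left side of the hypothesis. The separators come from the congruence of prod_{l > j} G_l to
  p^(s-j) * m_0^K modulo prod_{i <= j} G_i: after division by p^(s-j) they behave like idempotents
  up to a p-adic unit.\<close>

hide_const (open) up_ring.coeff up_ring.monom module.smult

section \<open>Roots modulo prime powers\<close>

text \<open>The cofactor of \<open>y - x\<close> in \<open>y ^ n - x ^ n\<close> has n summands,
  each congruent to \<open>x ^ (n - 1)\<close> modulo \<open>y - x\<close> and hence modulo n, so it
  is itself divisible by n.\<close>

lemma dvd_power_diff_of_dvd_diff:
  fixes x y :: "'a::comm_ring_1"
  assumes "of_nat n dvd y - x"
  shows "of_nat n * (y - x) dvd y ^ n - x ^ n"
proof -
  have "y - x dvd y ^ i - x ^ i" for i
    by (simp add: power_diff_sumr2)
  hence "of_nat n dvd (\<Sum>i<n. (y ^ i - x ^ i) * x ^ (n - Suc i))"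
    using assms by (intro dvd_sum dvd_mult2) (metis dvd_trans)
  also have "(\<Sum>i<n. (y ^ i - x ^ i) * x ^ (n - Suc i)) =
      (\<Sum>i<n. x ^ (n - Suc i) * y ^ i) - (\<Sum>i<n. x ^ (n - 1))"
    unfolding sum_subtractf[symmetric]
    by (intro sum.cong refl) (auto simp: algebra_simps simp flip: power_add)
  finally have "of_nat n dvd (\<Sum>i<n. x ^ (n - Suc i) * y ^ i) - of_nat n * x ^ (n - 1)"
    by simp
  hence "of_nat n dvd (\<Sum>i<n. x ^ (n - Suc i) * y ^ i)"
    by (metis dvd_triv_left diff_add_cancel dvd_add)
  hence "of_nat n * (y - x) dvd (\<Sum>i<n. x ^ (n - Suc i) * y ^ i) * (y - x)"
    by (rule mult_dvd_mono) simp
  thus ?thesis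
    by (simp add: power_diff_sumr2 mult.commute)
qed

text \<open>Every p-th power gains one factor p. The general ring matters: the lemma is applied to
  integers and to integer polynomials.\<close>

lemma dvd_power_prime_power_diff:
  fixes x y :: "'a::comm_ring_1"
  assumes "of_nat p ^ Suc j dvd y - x"
  shows "of_nat p ^ (Suc j + t) dvd y ^ (p ^ t) - x ^ (p ^ t)"
proof (induction t)
  case (Suc t)
  have "of_nat p dvd y ^ (p ^ t) - x ^ (p ^ t)"
    using Suc.IH by (metis add_Suc dvd_trans dvd_triv_left power_Suc)
  from dvd_power_diff_of_dvd_diff[OF this]
  have "of_nat p * (y ^ p ^ t - x ^ p ^ t) dvd y ^ p ^ Suc t - x ^ p ^ Suc t"
    by (simp add: power_mult[symmetric] mult.commute)
  moreover have "of_nat p * of_nat p ^ (Suc j + t) dvd of_nat p * (y ^ p ^ t - x ^ p ^ t)"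
    using Suc.IH by (intro mult_dvd_mono) auto
  ultimately show ?case by (metis add_Suc_right dvd_trans power_Suc)
qed (use assms in simp)

lemma one_plus_power_expansion:
  fixes v :: "'a::comm_ring_1"
  shows "\<exists>w. (1 + v) ^ n = 1 + of_nat n * v + of_nat (n choose 2) * v^2 + v^3 * w"
proof (induction n)
  case 0
  show ?case by (intro exI[of _ 0]) (simp add: numeral_2_eq_2)
next
  case (Suc n)
  then obtain w where w: "(1 + v) ^ n = 1 + of_nat n * v + of_nat (n choose 2) * v^2 + v^3 * w" ..
  have "Suc n choose 2 = n + (n choose 2)" by (simp add: numeral_2_eq_2)
  hence "(1 + v) ^ Suc n = 1 + of_nat (Suc n) * v + of_nat (Suc n choose 2) * v^2
      + v^3 * (w + v * w + of_nat (n choose 2))"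
    by (simp add: w algebra_simps power2_eq_square power3_eq_cube)
  thus ?case by blast
qed

text \<open>The root extraction below uses that p is odd through this fact: for p = 2 the quadratic
  term of \<open>(1 + v) ^ p\<close> would not be negligible.\<close>

lemma odd_dvd_choose_2:
  assumes "odd (p::nat)"
  shows "p dvd p choose 2"
proof -
  obtain k where k: "p = 2 * k + 1" using assms by (auto elim: oddE)
  have "p choose 2 = p * k" by (simp add: choose_two k)
  thus ?thesis by simp
qed

text \<open>Newton iteration from the approximate root 1: multiplying x by \<open>1 + v\<close>
  multiplies \<open>x ^ p\<close> by about \<open>1 + p * v\<close>, which gains one digit of
  precision per step.\<close>

lemma exists_pth_root_mod:
  fixes y :: int
  assumes "odd p" "prime p" and y: "int p ^ (j + 2) dvd y - 1"
  shows "\<exists>x. int p ^ (j + 1) dvd x - 1 \<and> int p ^ (j + 2 + k) dvd x ^ p - y"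
proof (induction k)
  case 0
  show ?case by (rule exI[of _ 1]) (use y in \<open>simp add: dvd_diff_commute\<close>)
next
  case (Suc k)
  then obtain x where x: "int p ^ (j + 1) dvd x - 1" "int p ^ (j + 2 + k) dvd x ^ p - y" by blast
  then obtain c where c: "x ^ p = y + int p ^ (j + 2 + k) * c"
    by (metis dvdE add.commute diff_add_cancel)
  \<comment> \<open>Chosen so that \<open>p * v\<close> is minus the error term; since
    \<open>x ^ p\<close> is 1 modulo p, the correction cancels the error up to one more factor
    p.\<close>
  define v where "v = int p ^ (j + 1 + k) * (- c)"
  obtain w where w: "(1 + v) ^ p = 1 + int p * v + int (p choose 2) * v^2 + v^3 * w"
    using one_plus_power_expansion[of v p] by auto
  let ?P = "int p ^ (j + 3 + k)"
  have "?P dvd int p * (int p ^ (j + 1 + k)) ^ 2"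
    unfolding power_mult[symmetric] power_Suc[symmetric] by (rule le_imp_power_dvd) simp
  hence 1: "?P dvd int (p choose 2) * v^2"
  proof (rule dvd_trans)
    have "int p dvd int (p choose 2)" using odd_dvd_choose_2[OF assms(1)] by simp
    thus "int p * (int p ^ (j + 1 + k)) ^ 2 dvd int (p choose 2) * v^2"
      by (rule mult_dvd_mono) (simp add: v_def power_mult_distrib)
  qed
  have "?P dvd (int p ^ (j + 1 + k)) ^ 3"
    unfolding power_mult[symmetric] by (rule le_imp_power_dvd) simp
  hence 2: "?P dvd v^3 * w"
    unfolding v_def power_mult_distrib by (intro dvd_mult2)
  from 1 2 have A: "?P dvd (1 + v) ^ p - (1 + int p * v)"
    unfolding w by (simp add: dvd_add)
  have "int p dvd x - 1" using x(1) by (auto intro: dvd_mult_left)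
  hence "int p dvd x ^ p - 1"
    by (simp add: power_diff_1_eq)
  hence "int p dvd c * (1 - x ^ p)" by (simp add: dvd_diff_commute)
  hence B: "?P dvd int p ^ (j + 2 + k) * (c * (1 - x ^ p))"
    using mult_dvd_mono[of "int p ^ (j + 2 + k)" "int p ^ (j + 2 + k)" "int p" "c * (1 - x ^ p)"]
    by (simp add: eval_nat_numeral mult_ac)
  have "(x * (1 + v)) ^ p - y = x ^ p * ((1 + v) ^ p - (1 + int p * v)) + (x ^ p * (1 + int p * v) - y)"
    unfolding power_mult_distrib by (simp add: right_diff_distrib)
  also have "x ^ p * (1 + int p * v) - y = int p ^ (j + 2 + k) * (c * (1 - x ^ p))"
  proof -
    have "x ^ p * (int p * v) = - (int p ^ (j + 2 + k) * (c * x ^ p))"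
      by (simp add: v_def algebra_simps)
    moreover have "x ^ p - y = int p ^ (j + 2 + k) * c" by (simp add: c)
    ultimately show ?thesis by (simp add: distrib_left right_diff_distrib)
  qed
  finally have "?P dvd (x * (1 + v)) ^ p - y"
    using A B by (simp add: dvd_add)
  moreover have "int p ^ (j + 1) dvd x * (1 + v) - 1"
  proof -
    have "int p ^ (j + 1) dvd v" unfolding v_def by (simp add: power_add)
    hence "int p ^ (j + 1) dvd (x - 1) + x * v" using x(1) by (intro dvd_add) auto
    thus ?thesis by (simp add: algebra_simps)
  qed
  ultimately show ?case by (intro exI[of _ "x * (1 + v)"]) (simp add: eval_nat_numeral)
qed

text \<open>Each p-th root costs one power of p in the congruence to 1, so \<open>s + 1\<close>
  powers allow s extractions.\<close>

lemma exists_prime_power_root_mod_of_one: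
  fixes y :: int
  assumes "odd p" "prime p" and "int p ^ (s + 1) dvd y - 1"
  shows "\<exists>x. int p dvd x - 1 \<and> int p ^ N dvd x ^ (p ^ s) - y"
  using assms(3)
proof (induction s arbitrary: y)
  case 0
  thus ?case by (intro exI[of _ y]) simp
next
  case (Suc s)
  obtain z where z: "int p ^ (s + 1) dvd z - 1" "int p ^ (s + 2 + N) dvd z ^ p - y"
    using exists_pth_root_mod[OF assms(1,2), of s y N] Suc.prems by auto
  obtain x where x: "int p dvd x - 1" "int p ^ N dvd x ^ (p ^ s) - z"
    using Suc.IH[OF z(1)] by blast
  have "x ^ (p ^ s) - z dvd (x ^ (p ^ s)) ^ p - z ^ p"
    by (simp add: power_diff_sumr2)
  hence "int p ^ N dvd (x ^ (p ^ s)) ^ p - z ^ p" using x(2) by (rule dvd_trans[rotated])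
  moreover have "int p ^ N dvd z ^ p - y"
    using z(2) by (metis dvd_mult_right power_add)
  ultimately have "int p ^ N dvd (x ^ (p ^ s)) ^ p - y"
    by (metis dvd_add diff_add_cancel add_diff_eq)
  thus ?case using x(1) by (intro exI[of _ x]) (simp add: power_mult[symmetric] mult.commute)
qed

text \<open>Only \<open>m ^ (p - 1)\<close> is near 1. Write p^s = 1 + (p - 1) h; if x is a p^s-th
  root of \<open>m ^ (p - 1)\<close>, then m * x^(-h) is one of m.\<close>

lemma exists_prime_power_root_mod:
  fixes m :: int
  assumes p: "odd p" "prime p" and m: "int p ^ (s + 1) dvd m ^ (p - 1) - 1"
  shows "\<exists>x. int p ^ N dvd x ^ (p ^ s) - m"
proof -
  obtain x where x: "int p dvd x - 1" "int p ^ N dvd x ^ (p ^ s) - m ^ (p - 1)"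
    using exists_prime_power_root_mod_of_one[OF p m] by blast
  have p0: "p > 0" using p by (simp add: prime_gt_0_nat)
  have "\<not> int p dvd x"
  proof
    assume "int p dvd x"
    from dvd_diff[OF this x(1)] have "int p dvd 1" by simp
    thus False using p(2) by simp
  qed
  hence "coprime x (int p ^ N)"
    using p(2) prime_imp_coprime[of "int p" x] by (simp add: coprime_commute)
  then obtain x' where x': "[x * x' = 1] (mod int p ^ N)"
    using cong_solve_coprime_int by blast
  have "int (p - 1) dvd int p ^ s - 1"
    using p0 power_diff_sumr2[of "int p" s 1] by (simp add: of_nat_diff)
  then obtain h' where h': "int p ^ s - 1 = int (p - 1) * h'" by blast
  obtain h where h: "p ^ s = 1 + (p - 1) * h"
  proof (rule that[of "nat h'"])
    have "p - 1 > 0" using prime_gt_1_nat[OF p(2)] by simp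
    moreover have "int p ^ s - 1 \<ge> 0" using p0 by simp
    ultimately have "h' \<ge> 0" using h' by (simp add: zero_le_mult_iff)
    hence "int (p ^ s) = int (1 + (p - 1) * nat h')" using h' by simp
    thus "p ^ s = 1 + (p - 1) * nat h'" by linarith
  qed
  have "(m * x' ^ h) ^ (p ^ s) = m * (m ^ (p - 1)) ^ h * x' ^ (h * p ^ s)"
    by (subst power_mult_distrib, subst h, simp add: power_add power_mult)
  also have "[\<dots> = m * (x ^ (p ^ s)) ^ h * x' ^ (h * p ^ s)] (mod int p ^ N)"
    using x(2) by (intro cong_mult cong_refl cong_pow) (simp add: cong_iff_dvd_diff dvd_diff_commute)
  also have "m * (x ^ (p ^ s)) ^ h * x' ^ (h * p ^ s) = m * (x * x') ^ (h * p ^ s)"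
    by (simp add: power_mult_distrib power_mult[symmetric] mult.commute)
  also have "[\<dots> = m * 1 ^ (h * p ^ s)] (mod int p ^ N)"
    using x' by (intro cong_mult cong_refl cong_pow)
  finally show ?thesis by (auto simp: cong_iff_dvd_diff)
qed

section \<open>Localisation at a prime ideal with a parameter\<close>

text \<open>Axioms for the localisation of R/(G) at M to have its maximal ideal generated by a
  non-zero-divisor \<pi>. Neither quotient nor localisation is built: a multiplier \<open>a\<close>
  outside M plays the denominator, and equality in the quotient becomes divisibility by G.\<close>

locale prime_ideal_with_parameter =
  fixes M :: "'a::idom set" and G \<pi> :: 'a
  assumes M_add: "x \<in> M \<Longrightarrow> y \<in> M \<Longrightarrow> x + y \<in> M"
    and M_mult: "x \<in> M \<Longrightarrow> y * x \<in> M"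
    and one_notin_M: "1 \<notin> M"
    and M_prime: "x \<notin> M \<Longrightarrow> y \<notin> M \<Longrightarrow> x * y \<notin> M"
    and G_in_M: "G \<in> M"
    and \<pi>_in_M: "\<pi> \<in> M"
    and M_generated: "y \<in> M \<Longrightarrow> \<exists>a q r. a \<notin> M \<and> a * y = G * q + \<pi> * r"
    and regular: "G dvd \<pi> * f \<Longrightarrow> G dvd f"
begin

text \<open>The elements whose valuation in the discrete valuation ring $R_M/(G)$ is at least $j$.\<close>
definition J :: "nat \<Rightarrow> 'a set" where
  "J j = {f. \<exists>a q r. a \<notin> M \<and> a * f = G * q + \<pi> ^ j * r}"

lemma JI: "a \<notin> M \<Longrightarrow> a * f = G * q + \<pi> ^ j * r \<Longrightarrow> f \<in> J j"
  unfolding J_def by blast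

lemma JE:
  assumes "f \<in> J j"
  obtains a q r where "a \<notin> M" "a * f = G * q + \<pi> ^ j * r"
  using assms unfolding J_def by blast

lemma M_mult2: "x \<in> M \<Longrightarrow> x * y \<in> M"
  using M_mult[of x y] by (simp add: mult.commute)

lemma M_uminus: "x \<in> M \<Longrightarrow> - x \<in> M"
  using M_mult[of x "-1"] by simp

lemma M_diff: "x \<in> M \<Longrightarrow> y \<in> M \<Longrightarrow> x - y \<in> M"
  using M_add[of x "- y"] M_uminus[of y] by simp

lemma M_sum: "(\<And>i. i \<in> A \<Longrightarrow> f i \<in> M) \<Longrightarrow> sum f A \<in> M"
proof (induction A rule: infinite_finite_induct)
  case (infinite A)
  show ?case using M_mult[OF G_in_M, of 0] infinite by simp
next
  case empty
  show ?case using M_mult[OF G_in_M, of 0] by simp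
qed (auto intro: M_add)

lemma J_add: "f \<in> J j \<Longrightarrow> g \<in> J j \<Longrightarrow> f + g \<in> J j"
proof -
  assume "f \<in> J j" "g \<in> J j"
  then obtain a q r a' q' r' where *: "a \<notin> M" "a * f = G * q + \<pi> ^ j * r"
    "a' \<notin> M" "a' * g = G * q' + \<pi> ^ j * r'" by (meson JE)
  have "(a * a') * (f + g) = a' * (a * f) + a * (a' * g)" by (simp add: algebra_simps)
  also have "\<dots> = G * (a' * q + a * q') + \<pi> ^ j * (a' * r + a * r')"
    unfolding * by (simp add: algebra_simps)
  finally show ?thesis using M_prime * by (metis JI)
qed

lemma J_mult: "f \<in> J i \<Longrightarrow> g \<in> J j \<Longrightarrow> f * g \<in> J (i + j)"
proof -
  assume "f \<in> J i" "g \<in> J j"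
  then obtain a q r a' q' r' where *: "a \<notin> M" "a * f = G * q + \<pi> ^ i * r"
    "a' \<notin> M" "a' * g = G * q' + \<pi> ^ j * r'" by (meson JE)
  have "(a * a') * (f * g) = (a * f) * (a' * g)" by (simp add: algebra_simps)
  also have "\<dots> = G * (q * (G * q' + \<pi> ^ j * r') + \<pi> ^ i * r * q') + \<pi> ^ (i + j) * (r * r')"
    unfolding * by (simp add: algebra_simps power_add)
  finally show ?thesis using M_prime * by (metis JI)
qed

lemma J_0: "f \<in> J 0"
  by (rule JI[OF one_notin_M, of _ 0 _ f]) simp

lemma J_scale: "f \<in> J j \<Longrightarrow> g * f \<in> J j"
  using J_mult[OF J_0, of f j] by simp

lemma J_uminus: "f \<in> J j \<Longrightarrow> - f \<in> J j"
  using J_scale[of f j "-1"] by simp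

lemma J_diff: "f \<in> J j \<Longrightarrow> g \<in> J j \<Longrightarrow> f - g \<in> J j"
  using J_add[of f j "- g"] J_uminus[of g] by simp

lemma J_mono: "i \<le> j \<Longrightarrow> f \<in> J j \<Longrightarrow> f \<in> J i"
proof -
  assume "i \<le> j" "f \<in> J j"
  then obtain a q r where *: "a \<notin> M" "a * f = G * q + \<pi> ^ j * r" by (meson JE)
  have "\<pi> ^ j = \<pi> ^ i * \<pi> ^ (j - i)" using \<open>i \<le> j\<close> by (simp flip: power_add)
  thus ?thesis using * by (intro JI[OF *(1), of _ q _ "\<pi> ^ (j - i) * r"]) (simp add: algebra_simps)
qed

lemma G_dvd_in_J: "G dvd f \<Longrightarrow> f \<in> J j"
  by (elim dvdE) (auto intro!: JI[OF one_notin_M, of _ _ _ 0])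

lemma J_sum: "(\<And>i. i \<in> A \<Longrightarrow> f i \<in> J j) \<Longrightarrow> sum f A \<in> J j"
  by (induction A rule: infinite_finite_induct) (auto intro: J_add G_dvd_in_J)

lemma J_power: "f \<in> J i \<Longrightarrow> f ^ k \<in> J (i * k)"
proof (induction k)
  case (Suc k)
  show ?case using J_mult[OF Suc.prems Suc.IH[OF Suc.prems]] by simp
qed (simp add: J_0)

lemma regular_power: "G dvd \<pi> ^ j * f \<Longrightarrow> G dvd f"
proof (induction j arbitrary: f)
  case (Suc j)
  have "G dvd \<pi> ^ j * (\<pi> * f)" using Suc.prems by (simp add: algebra_simps)
  thus ?case using Suc.IH regular by blast
qed simp

text \<open>The coefficient of \<open>\<pi> ^ j\<close> in an expansion of f is determined modulo M
  up to units: two expansions are compared and \<open>\<pi> ^ j\<close> is cancelled modulo G by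
  \<open>regular_power\<close>.\<close>

lemma in_J_Suc_iff:
  assumes "a \<notin> M" "a * f = G * q + \<pi> ^ j * y"
  shows "f \<in> J (Suc j) \<longleftrightarrow> y \<in> M"
proof
  assume "y \<in> M"
  then obtain a' q' r' where *: "a' \<notin> M" "a' * y = G * q' + \<pi> * r'" using M_generated by blast
  have "(a' * a) * f = a' * (a * f)" by (simp add: algebra_simps)
  also have "\<dots> = a' * (G * q) + \<pi> ^ j * (a' * y)" unfolding assms by (simp add: algebra_simps)
  also have "\<dots> = G * (a' * q + \<pi> ^ j * q') + \<pi> ^ Suc j * r'" unfolding * by (simp add: algebra_simps)
  finally show "f \<in> J (Suc j)" using M_prime * assms by (metis JI)
next
  assume "f \<in> J (Suc j)"
  then obtain a' q' r' where *: "a' \<notin> M" "a' * f = G * q' + \<pi> ^ Suc j * r'" by (meson JE)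
  have "\<pi> ^ j * (a' * y - a * (\<pi> * r')) = a' * (a * f - G * q) - a * (a' * f - G * q')"
    unfolding assms * by (simp add: algebra_simps)
  also have "\<dots> = G * (a * q' - a' * q)" by (simp add: algebra_simps)
  finally have "G dvd \<pi> ^ j * (a' * y - a * (\<pi> * r'))" by simp
  hence "G dvd a' * y - a * (\<pi> * r')" by (rule regular_power)
  hence "a' * y - a * (\<pi> * r') \<in> M" using M_mult2[OF G_in_M] by (auto elim: dvdE)
  hence "a' * y \<in> M" using M_add M_mult[OF M_mult2[OF \<pi>_in_M]] by (metis diff_add_cancel)
  thus "y \<in> M" using M_prime * by blast
qed

lemma J_1: "J (Suc 0) = M"
  using in_J_Suc_iff[OF one_notin_M, of _ 0 0] by auto

text \<open>A relation rather than a valuation function, because multiples of G lie in every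
  \<open>J j\<close> and have no finite order.\<close>

definition exact_order :: "nat \<Rightarrow> 'a \<Rightarrow> bool" where
  "exact_order j f \<longleftrightarrow> f \<in> J j \<and> f \<notin> J (Suc j)"

lemma exact_order_unit: "f \<notin> M \<Longrightarrow> exact_order 0 f"
  unfolding exact_order_def J_1 using J_0 by auto

text \<open>The leading coefficients multiply, and their product stays outside the prime ideal
  M.\<close>

lemma exact_order_mult:
  assumes "exact_order i f" "exact_order j g"
  shows "exact_order (i + j) (f * g)"
proof -
  obtain a q r a' q' r' where *: "a \<notin> M" "a * f = G * q + \<pi> ^ i * r"
    "a' \<notin> M" "a' * g = G * q' + \<pi> ^ j * r'" using assms unfolding exact_order_def by (meson JE)
  have r: "r \<notin> M" "r' \<notin> M"
    using in_J_Suc_iff[OF *(1,2)] in_J_Suc_iff[OF *(3,4)] assms unfolding exact_order_def by auto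
  have "(a * a') * (f * g) = (a * f) * (a' * g)" by (simp add: algebra_simps)
  also have "\<dots> = G * (q * (G * q' + \<pi> ^ j * r') + \<pi> ^ i * r * q') + \<pi> ^ (i + j) * (r * r')"
    unfolding * by (simp add: algebra_simps power_add)
  finally have "f * g \<in> J (Suc (i + j)) \<longleftrightarrow> r * r' \<in> M"
    using M_prime * by (intro in_J_Suc_iff) auto
  thus ?thesis using assms r M_prime J_mult unfolding exact_order_def by blast
qed

lemma exact_order_power:
  assumes "exact_order i f"
  shows "exact_order (i * k) (f ^ k)"
proof (induction k)
  case 0
  show ?case using exact_order_unit[OF one_notin_M] by simp
next
  case (Suc k)
  show ?case using exact_order_mult[OF assms Suc.IH] by simp
qed

lemma exact_order_exists:
  assumes "f \<notin> J k"
  obtains j where "j < k" "exact_order j f"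
proof -
  define j where "j = (LEAST j. f \<notin> J j)"
  have j: "f \<notin> J j" unfolding j_def using assms by (rule LeastI)
  hence "j \<noteq> 0" using J_0 by metis
  then obtain j' where j': "j = Suc j'" by (cases j) auto
  hence "f \<in> J j'" using not_less_Least[of j' "\<lambda>j. f \<notin> J j"] by (auto simp: j_def)
  moreover have "j \<le> k" unfolding j_def using assms by (rule Least_le)
  ultimately show ?thesis using that[of j'] j j' unfolding exact_order_def by auto
qed

lemma exact_order_le: "exact_order i f \<Longrightarrow> f \<in> J j \<Longrightarrow> j \<le> i"
  unfolding exact_order_def by (meson J_mono not_less_eq_eq)

text \<open>The leading coefficient of p lies outside M, so cross-multiplying the two expansions
  eliminates \<open>\<pi> ^ j\<close> and leaves an admissible multiplier of f.\<close>

lemma dvd_of_exact_order: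
  assumes p: "exact_order j p" and f: "f \<in> J j"
  shows "\<exists>a y. a \<notin> M \<and> G dvd a * f - p * y"
proof -
  obtain a q r where *: "a \<notin> M" "a * p = G * q + \<pi> ^ j * r"
    using p unfolding exact_order_def by (meson JE)
  obtain a' q' r' where **: "a' \<notin> M" "a' * f = G * q' + \<pi> ^ j * r'" using f by (meson JE)
  have "r \<notin> M" using in_J_Suc_iff[OF *] p unfolding exact_order_def by blast
  have "(r * a') * f - p * (a * r') = r * (a' * f) - r' * (a * p)" by (simp add: algebra_simps)
  also have "\<dots> = G * (r * q' - r' * q)" unfolding * ** by (simp add: algebra_simps)
  finally show ?thesis using M_prime[OF \<open>r \<notin> M\<close> **(1)] by (metis dvd_triv_left)
qed

text \<open>Integral closedness of the valuation ring: an equation of integral dependence for $b/L$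
  that holds up to a high power of $p$ already forces $L \mid b$.\<close>
lemma dvd_of_integral_equation:
  assumes p: "exact_order e p" and e: "e > 0" and k: "k > 0" and D: "D \<notin> M" and L: "L = p ^ c * D"
    and eq: "b ^ k + (\<Sum>i<k. a i * b ^ i * L ^ (k - i)) \<in> J (e * (c * k))"
  shows "\<exists>a y. a \<notin> M \<and> G dvd a * b - L * y"
proof -
  have Lo: "exact_order (e * c) L"
    using exact_order_mult[OF exact_order_power[OF p] exact_order_unit[OF D]] unfolding L by simp
  have "b \<in> J (e * c)"
  \<comment> \<open>If b had order j < e * c, every term of the sum would have order above j * k,
    and so would the whole equation; but \<open>b ^ k\<close> has order exactly j * k.\<close>
  proof (rule ccontr)
    assume "b \<notin> J (e * c)"
    then obtain j where j: "j < e * c" "exact_order j b" by (rule exact_order_exists)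
    have "(\<Sum>i<k. a i * b ^ i * L ^ (k - i)) \<in> J (Suc (j * k))"
    proof (rule J_sum)
      fix i assume i: "i \<in> {..<k}"
      have "b ^ i \<in> J (j * i)" "L ^ (k - i) \<in> J (e * c * (k - i))"
        using j Lo by (auto intro!: J_power simp: exact_order_def)
      hence "a i * b ^ i * L ^ (k - i) \<in> J (j * i + e * c * (k - i))"
        by (intro J_mult J_scale)
      moreover have "Suc (j * k) \<le> j * i + e * c * (k - i)"
      proof -
        have "Suc j * (k - i) \<le> e * c * (k - i)" using j(1) by (intro mult_right_mono) auto
        moreover have "k = i + (k - i)" "k - i > 0" using i by auto
        hence "j * k = j * i + j * (k - i)" by (metis add_mult_distrib2)
        ultimately show ?thesis using \<open>k - i > 0\<close> by simp
      qed
      ultimately show "a i * b ^ i * L ^ (k - i) \<in> J (Suc (j * k))" by (rule J_mono[rotated])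
    qed
    moreover have "Suc (j * k) \<le> e * (c * k)"
    proof -
      have "Suc j * k \<le> e * c * k" using j(1) by (intro mult_right_mono) auto
      thus ?thesis using k by simp
    qed
    with eq have "b ^ k + (\<Sum>i<k. a i * b ^ i * L ^ (k - i)) \<in> J (Suc (j * k))" by (rule J_mono[rotated])
    ultimately have "b ^ k \<in> J (Suc (j * k))" using J_diff by fastforce
    thus False using exact_order_power[OF j(2), of k] unfolding exact_order_def by blast
  qed
  thus ?thesis by (rule dvd_of_exact_order[OF Lo])
qed

text \<open>Here \<tau> stands for b/L and \<gamma> for g/p^l. The relation \<open>eq\<close> is a
  relation between b/L and g cleared of denominators and known up to order \<open>e * N\<close>;
  dividing by \<open>p ^ l * L ^ k\<close>, of order e * (l + c * k), still leaves positive order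
  because of the bound on N.\<close>

lemma residue_eq:
  assumes p: "exact_order e p" and e: "e > 0" and D: "D \<notin> M" and L: "L = p ^ c * D"
    and a0: "a0 - 1 \<in> M" "G dvd a0 * b - L * \<tau>"
    and eq: "p ^ l * (\<Sum>i<k. f i * b ^ i * L ^ (k - i)) - g * L ^ k \<in> J (e * N)"
    and N: "N > c * k + l" and g: "G dvd g - p ^ l * \<gamma>"
  shows "(\<Sum>i<k. f i * \<tau> ^ i) - \<gamma> \<in> M"
proof -
  \<comment> \<open>The difference f(\<tau>) - \<gamma> homogenised by the multiplier
    \<open>a0\<close>. As \<open>a0\<close> is 1 modulo M, this does not change the residue.\<close>
  define h where "h = (\<Sum>i<k. f i * \<tau> ^ i * a0 ^ (k - i)) - \<gamma> * a0 ^ k"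
  have a0_pow: "a0 ^ j - 1 \<in> M" for j
    using M_mult2[OF a0(1)] by (simp add: power_diff_1_eq)
  have 1: "G dvd a0 ^ k * (f i * b ^ i * L ^ (k - i)) - L ^ k * (f i * \<tau> ^ i * a0 ^ (k - i))"
    if "i < k" for i
  proof -
    have "G dvd (a0 * b) ^ i - (L * \<tau>) ^ i"
      using a0(2) by (metis dvd_mult2 dvd_trans power_diff_sumr2)
    hence "G dvd (f i * L ^ (k - i) * a0 ^ (k - i)) * ((a0 * b) ^ i - (L * \<tau>) ^ i)" by (rule dvd_mult)
    also have "\<dots> = (a0 ^ i * a0 ^ (k - i)) * (f i * b ^ i * L ^ (k - i))
        - (L ^ i * L ^ (k - i)) * (f i * \<tau> ^ i * a0 ^ (k - i))"
      by (simp add: power_mult_distrib algebra_simps)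
    finally show ?thesis using that by (simp flip: power_add)
  qed
  have "G dvd (\<Sum>i<k. a0 ^ k * (f i * b ^ i * L ^ (k - i)) - L ^ k * (f i * \<tau> ^ i * a0 ^ (k - i)))"
    using 1 by (intro dvd_sum) auto
  hence "G dvd a0 ^ k * (\<Sum>i<k. f i * b ^ i * L ^ (k - i))
      - L ^ k * (\<Sum>i<k. f i * \<tau> ^ i * a0 ^ (k - i))"
    by (simp add: sum_subtractf sum_distrib_left)
  from dvd_diff[OF dvd_mult[OF this, of "p ^ l"] dvd_mult[OF g, of "a0 ^ k * L ^ k"]]
  have "G dvd p ^ l * (a0 ^ k * (\<Sum>i<k. f i * b ^ i * L ^ (k - i))
      - L ^ k * (\<Sum>i<k. f i * \<tau> ^ i * a0 ^ (k - i))) - a0 ^ k * L ^ k * (g - p ^ l * \<gamma>)" .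
  also have "\<dots> = a0 ^ k * (p ^ l * (\<Sum>i<k. f i * b ^ i * L ^ (k - i)) - g * L ^ k) - p ^ l * L ^ k * h"
    unfolding h_def by (simp add: algebra_simps)
  finally have "a0 ^ k * (p ^ l * (\<Sum>i<k. f i * b ^ i * L ^ (k - i)) - g * L ^ k) - p ^ l * L ^ k * h \<in> J (e * N)"
    by (rule G_dvd_in_J)
  from J_diff[OF J_scale[OF eq, of "a0 ^ k"] this] have J: "p ^ l * L ^ k * h \<in> J (e * N)" by simp
  have h: "h \<in> M"
  proof (rule ccontr)
    assume "h \<notin> M"
    have "exact_order (e * c) L"
      using exact_order_mult[OF exact_order_power[OF p] exact_order_unit[OF D]] unfolding L by simp
    hence "exact_order (e * l + e * c * k + 0) (p ^ l * L ^ k * h)"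
      using p \<open>h \<notin> M\<close> by (intro exact_order_mult exact_order_power exact_order_unit)
    from exact_order_le[OF this J] have "e * N \<le> e * (l + c * k)" by (simp add: algebra_simps)
    thus False using N e by simp
  qed
  have "(\<Sum>i<k. f i * \<tau> ^ i * (a0 ^ (k - i) - 1)) \<in> M"
    by (intro M_sum M_mult a0_pow)
  hence "h - ((\<Sum>i<k. f i * \<tau> ^ i * (a0 ^ (k - i) - 1)) - \<gamma> * (a0 ^ k - 1)) \<in> M"
    by (intro M_diff[OF h] M_diff M_mult[OF a0_pow])
  also have "h - ((\<Sum>i<k. f i * \<tau> ^ i * (a0 ^ (k - i) - 1)) - \<gamma> * (a0 ^ k - 1))
      = (\<Sum>i<k. f i * \<tau> ^ i) - \<gamma>"
    unfolding h_def by (simp add: algebra_simps sum_subtractf)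
  finally show ?thesis .
qed

end

section \<open>Reduction of integer polynomials\<close>

abbreviation reduce :: "int poly \<Rightarrow> 'p::prime_card mod_ring poly" where
  "reduce \<equiv> map_poly of_int"

lemma reduce_eq_0_iff: "(reduce f :: 'p::prime_card mod_ring poly) = 0 \<longleftrightarrow> of_nat CARD('p) dvd f"
proof -
  have "of_nat CARD('p) dvd f \<longleftrightarrow> (\<forall>n. int CARD('p) dvd coeff f n)"
    by (simp add: of_nat_poly const_poly_dvd_iff)
  also have "\<dots> \<longleftrightarrow> (\<forall>n. (of_int (coeff f n) :: 'p mod_ring) = 0)"
    by (simp add: of_int_eq_0_iff_char_dvd)
  also have "\<dots> \<longleftrightarrow> (reduce f :: 'p mod_ring poly) = 0"
    by (simp add: poly_eq_iff coeff_map_poly)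
  finally show ?thesis by simp
qed

lemma of_nat_card_poly [simp]: "(of_nat CARD('p) :: 'p::prime_card mod_ring poly) = 0"
  by (simp add: of_nat_poly)

lemma exists_lift:
  fixes g :: "'p::prime_card mod_ring poly"
  obtains f where "reduce f = g"
proof (rule that[of "map_poly to_int_mod_ring g"])
  show "reduce (map_poly to_int_mod_ring g) = g"
    by (subst map_poly_map_poly) (auto simp: o_def of_int_of_int_mod_ring)
qed

lemma exists_monic_lift:
  fixes g :: "'p::prime_card mod_ring poly"
  assumes "monic g"
  obtains f where "reduce f = g" "monic f" "degree f = degree g"
proof (rule that[of "map_poly to_int_mod_ring g"])
  show "reduce (map_poly to_int_mod_ring g) = g"
    by (subst map_poly_map_poly) (auto simp: o_def of_int_of_int_mod_ring)
  show "degree (map_poly to_int_mod_ring g) = degree g"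
    by (rule degree_map_poly) simp
  thus "monic (map_poly to_int_mod_ring g)"
    using assms by (simp add: coeff_map_poly)
qed

lemma reduce_degree_monic:
  assumes "monic f"
  shows "degree (reduce f :: 'p::prime_card mod_ring poly) = degree f" "monic (reduce f :: 'p mod_ring poly)"
proof -
  show "degree (reduce f :: 'p mod_ring poly) = degree f"
    using assms by (intro map_poly_degree_eq) auto
  thus "monic (reduce f :: 'p mod_ring poly)" using assms by (simp add: coeff_map_poly)
qed

text \<open>Factors of a monic polynomial have leading coefficients 1 or -1, so reduction keeps
  their degrees and a factor that becomes a unit is one already over the integers.\<close>

lemma prime_elem_of_reduce_irreducible:
  fixes \<phi> :: "'p::prime_card mod_ring poly"
  assumes "irreducible \<phi>" "reduce \<Phi> = \<phi>" "monic \<Phi>"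
  shows "prime_elem \<Phi>"
proof (rule irreducible_imp_prime_elem, rule irreducibleI)
  show "\<Phi> \<noteq> 0" using assms by auto
  show "\<not> \<Phi> dvd 1"
  proof
    assume "\<Phi> dvd 1"
    then obtain y where "\<Phi> * y = 1" by (metis dvdE)
    hence "reduce \<Phi> * reduce y = (1 :: 'p mod_ring poly)" by (simp flip: hom_distribs)
    hence "\<phi> dvd 1" using assms(2) by (metis dvd_triv_left)
    thus False using assms(1) by (auto simp: irreducible_def)
  qed
  fix a b assume ab: "\<Phi> = a * b"
  have "lead_coeff a * lead_coeff b = 1" using assms(3) ab by (simp add: lead_coeff_mult)
  hence lc: "lead_coeff a = 1 \<and> lead_coeff b = 1 \<or> lead_coeff a = -1 \<and> lead_coeff b = -1"
    by (simp add: zmult_eq_1_iff)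
  have deg: "degree (reduce a :: 'p mod_ring poly) = degree a" "degree (reduce b :: 'p mod_ring poly) = degree b"
    using lc by (auto intro!: map_poly_degree_eq)
  have "\<phi> = reduce a * reduce b" using assms(2) ab by (simp add: hom_distribs)
  hence "reduce a dvd (1 :: 'p mod_ring poly) \<or> reduce b dvd (1 :: 'p mod_ring poly)"
    using assms(1) by (auto dest: irreducibleD)
  hence "degree a = 0 \<or> degree b = 0" using deg by (auto simp: poly_dvd_1)
  thus "a dvd 1 \<or> b dvd 1"
    using lc by (elim disjE) (auto simp: poly_dvd_1)
qed

lemma reduce_irreducible_dvd_const:
  fixes \<phi> :: "'p::prime_card mod_ring poly"
  assumes "irreducible \<phi>"
  shows "\<phi> dvd of_int k \<longleftrightarrow> int CARD('p) dvd k"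
proof
  assume "\<phi> dvd of_int k"
  show "int CARD('p) dvd k"
  proof (rule ccontr)
    assume "\<not> int CARD('p) dvd k"
    hence "(of_int k :: 'p mod_ring) \<noteq> 0" by (simp add: of_int_eq_0_iff_char_dvd)
    hence "(of_int k :: 'p mod_ring poly) dvd 1" by (simp add: of_int_poly is_unit_const_poly_iff)
    with \<open>\<phi> dvd of_int k\<close> have "\<phi> dvd 1" by (rule dvd_trans)
    thus False using assms by (auto simp: irreducible_def)
  qed
next
  assume "int CARD('p) dvd k"
  hence "(of_int k :: 'p mod_ring) = 0" by (simp add: of_int_eq_0_iff_char_dvd)
  thus "\<phi> dvd of_int k" by (simp add: of_int_poly)
qed

text \<open>For irreducible \<phi> this is the maximal ideal of Z[x] generated by p and any lift of
  \<phi>, described without choosing the lift.\<close>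

definition reduction_ideal :: "'p::prime_card mod_ring poly \<Rightarrow> int poly set" where
  "reduction_ideal \<phi> = {f. \<phi> dvd reduce f}"

lemma in_reduction_ideal_iff: "f \<in> reduction_ideal \<phi> \<longleftrightarrow> \<phi> dvd reduce f"
  by (simp add: reduction_ideal_def)

lemma reduction_ideal_card: "of_nat CARD('p) \<in> reduction_ideal (\<phi> :: 'p::prime_card mod_ring poly)"
  using reduce_eq_0_iff[of "of_nat CARD('p)", where 'p='p] by (simp add: in_reduction_ideal_iff)

lemma reduction_ideal_iff_generated:
  fixes \<phi> :: "'p::prime_card mod_ring poly"
  assumes "reduce \<Phi> = \<phi>"
  shows "f \<in> reduction_ideal \<phi> \<longleftrightarrow> (\<exists>A B. f = \<Phi> * A + of_nat CARD('p) * B)"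
proof
  assume "f \<in> reduction_ideal \<phi>"
  then obtain g where g: "reduce f = \<phi> * g" unfolding in_reduction_ideal_iff by (elim dvdE)
  obtain A where A: "reduce A = g" by (rule exists_lift)
  have "reduce (f - \<Phi> * A) = (0 :: 'p mod_ring poly)" using g A assms by (simp add: hom_distribs)
  then obtain B where "f - \<Phi> * A = of_nat CARD('p) * B" unfolding reduce_eq_0_iff by (elim dvdE)
  thus "\<exists>A B. f = \<Phi> * A + of_nat CARD('p) * B" by (metis add.commute diff_eq_eq)
next
  assume "\<exists>A B. f = \<Phi> * A + of_nat CARD('p) * B"
  then obtain A B where f: "f = \<Phi> * A + of_nat CARD('p) * B" by blast
  have "reduce (of_nat CARD('p) * B) = (0 :: 'p mod_ring poly)" by (simp add: reduce_eq_0_iff)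
  thus "f \<in> reduction_ideal \<phi>" using assms by (simp add: in_reduction_ideal_iff f hom_distribs)
qed

lemma reduction_ideal_invertible:
  fixes \<phi> :: "'p::prime_card mod_ring poly"
  assumes "irreducible \<phi>" "f \<notin> reduction_ideal \<phi>"
  shows "\<exists>g. f * g - 1 \<in> reduction_ideal \<phi>"
proof -
  have "coprime \<phi> (reduce f)"
    using assms prime_elem_imp_coprime[OF irreducible_imp_prime_elem[OF assms(1)]] by (simp add: in_reduction_ideal_iff)
  then obtain s t where st: "s * \<phi> + t * reduce f = 1"
    by (metis bezout_coefficients_fst_snd coprime_iff_gcd_eq_1)
  obtain g where g: "reduce g = t" by (rule exists_lift)
  have "reduce (f * g - 1) = - (\<phi> * s)" using st g by (simp add: hom_distribs algebra_simps)
  thus ?thesis by (metis in_reduction_ideal_iff dvd_minus_iff dvd_triv_left)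
qed

section \<open>Regularity criteria at (p, phi)\<close>

text \<open>The parameter is existential because it is p itself in the unramified case and a lift of
  \<phi> in the ramified one. What matters afterwards is that p has a finite positive order
  e.\<close>

definition regular_at :: "'p::prime_card mod_ring poly \<Rightarrow> int poly \<Rightarrow> bool" where
  "regular_at \<phi> G \<longleftrightarrow> (\<exists>\<pi> e. prime_ideal_with_parameter (reduction_ideal \<phi>) G \<pi> \<and> e > 0 \<and>
     prime_ideal_with_parameter.exact_order (reduction_ideal \<phi>) G \<pi> e (of_nat CARD('p)))"

lemma prime_ideal_with_parameterI:
  fixes \<phi> :: "'p::prime_card mod_ring poly"
  assumes "irreducible \<phi>" "G \<in> reduction_ideal \<phi>" "\<pi> \<in> reduction_ideal \<phi>"
    "\<And>y. y \<in> reduction_ideal \<phi> \<Longrightarrow> \<exists>a q r. a \<notin> reduction_ideal \<phi> \<and> a * y = G * q + \<pi> * r"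
    "\<And>f. G dvd \<pi> * f \<Longrightarrow> G dvd f"
  shows "prime_ideal_with_parameter (reduction_ideal \<phi>) G \<pi>"
proof
  show "1 \<notin> reduction_ideal \<phi>" using assms(1) by (auto simp: in_reduction_ideal_iff irreducible_def)
  show "x * y \<notin> reduction_ideal \<phi>" if "x \<notin> reduction_ideal \<phi>" "y \<notin> reduction_ideal \<phi>" for x y
    using that prime_elem_dvd_multD[OF irreducible_imp_prime_elem[OF assms(1)]]
    by (auto simp: in_reduction_ideal_iff hom_distribs)
  show "x + y \<in> reduction_ideal \<phi>" if "x \<in> reduction_ideal \<phi>" "y \<in> reduction_ideal \<phi>" for x y
    using that by (simp add: in_reduction_ideal_iff hom_distribs)
  show "y * x \<in> reduction_ideal \<phi>" if "x \<in> reduction_ideal \<phi>" for x y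
    using that by (simp add: in_reduction_ideal_iff hom_distribs)
qed (fact assms)+

text \<open>If \<phi> divides G exactly once modulo p, the cofactor is a unit at \<phi>, so the lift
  of \<phi> already lies in the localised ideal (G, p) and p serves as parameter.\<close>

lemma regular_at_unramified:
  fixes \<phi> :: "'p::prime_card mod_ring poly"
  assumes irr: "irreducible \<phi>" and G: "reduce G = \<phi> * \<psi>" and \<psi>: "\<not> \<phi> dvd \<psi>"
  shows "regular_at \<phi> G"
proof -
  let ?p = "of_nat CARD('p) :: int poly"
  let ?M = "reduction_ideal \<phi>"
  obtain \<Phi> where \<Phi>: "reduce \<Phi> = \<phi>" by (rule exists_lift)
  obtain \<Psi> where \<Psi>: "reduce \<Psi> = \<psi>" by (rule exists_lift)
  have "reduce (\<Phi> * \<Psi> - G) = (0 :: 'p mod_ring poly)" using G \<Phi> \<Psi> by (simp add: hom_distribs)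
  then obtain B where B: "\<Phi> * \<Psi> - G = ?p * B" unfolding reduce_eq_0_iff by (elim dvdE)
  interpret prime_ideal_with_parameter ?M G ?p
  proof (rule prime_ideal_with_parameterI[OF irr])
    show "G \<in> ?M" using G by (simp add: in_reduction_ideal_iff)
    show "?p \<in> ?M" by (rule reduction_ideal_card)
  next
    fix y assume "y \<in> ?M"
    then obtain C D where y: "y = \<Phi> * C + ?p * D" using reduction_ideal_iff_generated[OF \<Phi>] by blast
    have "\<Psi> * y = (\<Phi> * \<Psi> - G) * C + G * C + ?p * (\<Psi> * D)" by (simp add: y algebra_simps)
    also have "\<dots> = G * C + ?p * (B * C + \<Psi> * D)" by (simp add: B algebra_simps)
    finally show "\<exists>a q r. a \<notin> ?M \<and> a * y = G * q + ?p * r"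
      using \<psi> \<Psi> by (metis in_reduction_ideal_iff)
  next
    fix f assume "G dvd ?p * f"
    then obtain q where q: "?p * f = G * q" by (elim dvdE)
    have "reduce (G * q) = (0 :: 'p mod_ring poly)" by (simp add: reduce_eq_0_iff flip: q)
    moreover have "reduce G \<noteq> (0 :: 'p mod_ring poly)" using G irr \<psi> by auto
    ultimately have "reduce q = (0 :: 'p mod_ring poly)" by (simp add: hom_distribs)
    then obtain q' where "q = ?p * q'" unfolding reduce_eq_0_iff by (elim dvdE)
    hence "?p * f = ?p * (G * q')" using q by (simp add: algebra_simps)
    thus "G dvd f" by simp
  qed
  have "exact_order 1 ?p"
    using in_J_Suc_iff[OF one_notin_M, of ?p 0 1 1] one_notin_M J_1 reduction_ideal_card
    by (simp add: exact_order_def)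
  thus ?thesis unfolding regular_at_def using prime_ideal_with_parameter_axioms by (blast intro: zero_less_one)
qed

text \<open>An Eisenstein condition: B is a unit at \<phi>, so p * B = G - \<Phi> * A puts p into
  the localised ideal (G, \<Phi>), and \<Phi> serves as parameter.\<close>

lemma regular_at_ramified:
  fixes \<phi> :: "'p::prime_card mod_ring poly"
  assumes irr: "irreducible \<phi>" and \<Phi>: "reduce \<Phi> = \<phi>" "monic \<Phi>" and G0: "monic G"
    and G: "G = \<Phi> * A + of_nat CARD('p) * B" and B: "B \<notin> reduction_ideal \<phi>"
  shows "regular_at \<phi> G"
proof -
  let ?p = "of_nat CARD('p) :: int poly"
  let ?M = "reduction_ideal \<phi>"
  have prime: "prime_elem \<Phi>" using prime_elem_of_reduce_irreducible[OF irr \<Phi>] .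
  have p_notin: "\<not> \<Phi> dvd ?p"
  proof
    assume "\<Phi> dvd ?p"
    hence "degree \<Phi> \<le> degree ?p" by (intro dvd_imp_degree_le) auto
    hence "degree \<Phi> = 0" by simp
    hence "\<Phi> = 1" using \<Phi>(2) by (simp add: monic_degree_0)
    thus False using prime by simp
  qed
  interpret prime_ideal_with_parameter ?M G \<Phi>
  proof (rule prime_ideal_with_parameterI[OF irr])
    show "G \<in> ?M" using reduction_ideal_iff_generated[OF \<Phi>(1)] G by blast
    show "\<Phi> \<in> ?M" using \<Phi>(1) by (simp add: in_reduction_ideal_iff)
  next
    fix y assume "y \<in> ?M"
    then obtain C D where y: "y = \<Phi> * C + ?p * D" using reduction_ideal_iff_generated[OF \<Phi>(1)] by blast
    have "B * y = \<Phi> * (B * C) + (?p * B) * D" by (simp add: y algebra_simps)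
    also have "?p * B = G - \<Phi> * A" using G by simp
    also have "\<Phi> * (B * C) + (G - \<Phi> * A) * D = G * D + \<Phi> * (B * C - A * D)" by (simp add: algebra_simps)
    finally show "\<exists>a q r. a \<notin> ?M \<and> a * y = G * q + \<Phi> * r" using B by blast
  next
    fix f assume "G dvd \<Phi> * f"
    then obtain q where q: "\<Phi> * f = G * q" by (elim dvdE)
    \<comment> \<open>This makes \<Phi> cancellable modulo G: otherwise the prime \<Phi> would
      divide p * B, hence B.\<close>
    have "\<not> \<Phi> dvd G"
    proof
      assume "\<Phi> dvd G"
      hence "\<Phi> dvd ?p * B" unfolding G by (simp add: dvd_add_right_iff)
      hence "\<Phi> dvd B" using prime p_notin prime_elem_dvd_multD by blast
      thus False using B \<Phi>(1) by (auto simp: in_reduction_ideal_iff hom_distribs elim!: dvdE)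
    qed
    moreover have "\<Phi> dvd G * q" by (simp flip: q)
    ultimately have "\<Phi> dvd q" using prime prime_elem_dvd_multD by blast
    then obtain q' where "q = \<Phi> * q'" by (elim dvdE)
    hence "\<Phi> * f = \<Phi> * (G * q')" using q by (simp add: algebra_simps)
    thus "G dvd f" using prime by auto
  qed
  have "reduce G \<noteq> (0 :: 'p mod_ring poly)" using reduce_degree_monic(2)[OF G0, where 'p='p] by force
  moreover have "\<not> \<phi> dvd 1" using irr by (auto simp: irreducible_def)
  ultimately obtain \<psi> where \<psi>: "reduce G = \<phi> ^ multiplicity \<phi> (reduce G) * \<psi>" "\<not> \<phi> dvd \<psi>"
    by (rule multiplicity_decompose')
  define E where "E = multiplicity \<phi> (reduce G)"
  obtain \<Psi> where \<Psi>: "reduce \<Psi> = \<psi>" by (rule exists_lift)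
  have "reduce (\<Phi> ^ E * \<Psi> - G) = (0 :: 'p mod_ring poly)"
    using \<psi>(1) \<Phi> \<Psi> by (simp add: hom_distribs E_def)
  then obtain h where h: "\<Phi> ^ E * \<Psi> - G = ?p * h" unfolding reduce_eq_0_iff by (elim dvdE)
  have "exact_order 1 \<Phi>"
    using in_J_Suc_iff[OF one_notin_M, of \<Phi> 0 1 1] one_notin_M J_1 \<pi>_in_M
    by (simp add: exact_order_def)
  hence ex: "exact_order (1 * E + 0) (\<Phi> ^ E * \<Psi>)"
    using \<psi>(2) \<Psi> by (intro exact_order_mult exact_order_power exact_order_unit) (auto simp: in_reduction_ideal_iff)
  \<comment> \<open>The order of p is finite: modulo G, a multiple of p equals
    \<open>\<Phi> ^ E * \<Psi>\<close>, whose order is exactly the multiplicity E of \<phi> in the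
    reduction of G.\<close>
  have "?p \<notin> J (Suc E)"
  proof
    assume "?p \<in> J (Suc E)"
    hence "h * ?p + G \<in> J (Suc E)" by (intro J_add[OF J_scale G_dvd_in_J]) auto
    also have "h * ?p + G = \<Phi> ^ E * \<Psi>" using h by (simp add: algebra_simps)
    finally show False using ex by (simp add: exact_order_def)
  qed
  then obtain e where e: "exact_order e ?p" by (rule exact_order_exists)
  have "?p \<in> J (Suc 0)" using J_1 reduction_ideal_card by simp
  from exact_order_le[OF e this] have "e > 0" by simp
  thus ?thesis unfolding regular_at_def using e prime_ideal_with_parameter_axioms by blast
qed

lemma power_add_linear_part:
  fixes v w :: "'a::comm_ring_1"
  shows "\<exists>c. (w + v) ^ j = w ^ j + of_nat j * v * w ^ (j - 1) + v^2 * c"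
proof (induction j)
  case 0
  show ?case by (intro exI[of _ 0]) simp
next
  case (Suc j)
  then obtain c where c: "(w + v) ^ j = w ^ j + of_nat j * v * w ^ (j - 1) + v^2 * c" ..
  have *: "of_nat j * w ^ j = of_nat j * (w * w ^ (j - 1))" by (cases j) auto
  have "(w + v) ^ Suc j = w ^ Suc j + v * w ^ j + of_nat j * (w * w ^ (j - 1)) * v
      + v^2 * (of_nat j * w ^ (j - 1) + (w + v) * c)"
    unfolding power_Suc c by (simp add: algebra_simps power2_eq_square)
  also have "\<dots> = w ^ Suc j + of_nat (Suc j) * v * w ^ (Suc j - 1)
      + v^2 * (of_nat j * w ^ (j - 1) + (w + v) * c)"
    unfolding *[symmetric] by (simp add: algebra_simps)
  finally show ?case by blast
qed

text \<open>To first order in \<open>of_nat p * z\<close> the summands contribute a multiple of the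
  sum of all j < p, which is p(p-1)/2 and thus divisible by p for odd p. So the deviation from
  \<open>p * w ^ (p - 1)\<close> is divisible by p^2.\<close>

lemma sum_power_near_diagonal:
  fixes w z :: "'a::comm_ring_1"
  assumes "odd p"
  shows "\<exists>C. (\<Sum>j<p. (w + of_nat p * z) ^ j * w ^ (p - Suc j)) = of_nat p * (w ^ (p - 1) + of_nat p * C)"
proof -
  obtain c where c: "(w + of_nat p * z) ^ j = w ^ j + of_nat j * (of_nat p * z) * w ^ (j - 1) + (of_nat p * z)^2 * c j" for j
    using power_add_linear_part[of w "of_nat p * z"] by metis
  obtain k where k: "p = 2 * k + 1" using assms by (auto elim: oddE)
  have "(\<Sum>j<p. j) = p * k"
    using gauss_sum_nat[of "2 * k"] by (simp add: k lessThan_Suc_atMost atMost_atLeast0)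
  hence "of_nat (\<Sum>j<p. j) = (of_nat (p * k) :: 'a)" by (rule arg_cong)
  hence sum_j: "(\<Sum>j<p. of_nat j) = (of_nat p * of_nat k :: 'a)" by simp
  have "(w + of_nat p * z) ^ j * w ^ (p - Suc j) =
      w ^ (p - 1) + of_nat j * (of_nat p * z * w ^ (p - 2)) + of_nat p ^ 2 * (z^2 * c j * w ^ (p - Suc j))"
    if j: "j < p" for j
  proof -
    have 1: "w ^ j * w ^ (p - Suc j) = w ^ (p - 1)" using j by (simp flip: power_add)
    have 2: "of_nat j * (w ^ (j - 1) * w ^ (p - Suc j)) = of_nat j * w ^ (p - 2)"
    proof (cases "j = 0")
      case False
      hence "j - 1 + (p - Suc j) = p - 2" using j by simp
      thus ?thesis by (metis power_add)
    qed simp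
    have "(w + of_nat p * z) ^ j * w ^ (p - Suc j) = w ^ j * w ^ (p - Suc j)
        + (of_nat p * z) * (of_nat j * (w ^ (j - 1) * w ^ (p - Suc j)))
        + (of_nat p * z)^2 * c j * w ^ (p - Suc j)"
      by (subst c) (simp add: algebra_simps)
    thus ?thesis unfolding 1 2 by (simp add: algebra_simps power_mult_distrib)
  qed
  hence "(\<Sum>j<p. (w + of_nat p * z) ^ j * w ^ (p - Suc j)) =
    (\<Sum>j<p. w ^ (p - 1) + of_nat j * (of_nat p * z * w ^ (p - 2)) + of_nat p ^ 2 * (z^2 * c j * w ^ (p - Suc j)))"
    by (intro sum.cong) auto
  also have "\<dots> = of_nat p * w ^ (p - 1) + (of_nat p * of_nat k) * (of_nat p * z * w ^ (p - 2))
      + of_nat p ^ 2 * (\<Sum>j<p. z^2 * c j * w ^ (p - Suc j))"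
    by (simp only: sum.distrib sum_distrib_left[symmetric] sum_distrib_right[symmetric] sum_j)
      (simp add: sum_distrib_left)
  also have "\<dots> = of_nat p * (w ^ (p - 1) + of_nat p * (of_nat k * z * w ^ (p - 2)
      + (\<Sum>j<p. z^2 * c j * w ^ (p - Suc j))))"
    by (simp add: algebra_simps power2_eq_square)
  finally show ?thesis by blast
qed

text \<open>Modulo \<Phi> the element W may be replaced by \<open>W0\<close>, which is w plus a
  multiple of p. There G takes the value p times something congruent to \<open>w ^ (p - 1)\<close>,
  a unit, so the ramified criterion applies.\<close>

lemma regular_at_cyclotomic:
  fixes \<phi> :: "'p::prime_card mod_ring poly"
  assumes irr: "irreducible \<phi>" "monic \<phi>" and odd: "odd CARD('p)" and w: "\<not> int CARD('p) dvd w"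
    and W: "W - of_int w \<in> reduction_ideal \<phi>" and G: "monic G"
      "G = (\<Sum>j<CARD('p). W ^ j * of_int w ^ (CARD('p) - Suc j))"
  shows "regular_at \<phi> G"
proof -
  let ?p = "of_nat CARD('p) :: int poly"
  obtain \<Phi> where \<Phi>: "reduce \<Phi> = \<phi>" "monic \<Phi>" using exists_monic_lift[OF irr(2)] by metis
  obtain A B where AB: "W - of_int w = \<Phi> * A + ?p * B"
    using W reduction_ideal_iff_generated[OF \<Phi>(1)] by blast
  define W0 where "W0 = of_int w + ?p * B"
  obtain C where C: "(\<Sum>j<CARD('p). W0 ^ j * of_int w ^ (CARD('p) - Suc j))
      = ?p * (of_int w ^ (CARD('p) - 1) + ?p * C)"
    using sum_power_near_diagonal[OF odd, of "of_int w" B] unfolding W0_def by blast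
  have "\<Phi> dvd W - W0" using AB by (simp add: W0_def algebra_simps)
  hence "\<Phi> dvd W ^ j - W0 ^ j" for j by (metis dvd_mult2 power_diff_sumr2)
  hence "\<Phi> dvd (\<Sum>j<CARD('p). (W ^ j - W0 ^ j) * of_int w ^ (CARD('p) - Suc j))"
    by (intro dvd_sum dvd_mult2)
  also have "\<dots> = G - ?p * (of_int w ^ (CARD('p) - 1) + ?p * C)"
    unfolding C[symmetric] G(2) by (simp add: algebra_simps sum_subtractf)
  finally obtain A' where A': "G = \<Phi> * A' + ?p * (of_int w ^ (CARD('p) - 1) + ?p * C)"
    by (metis dvdE diff_eq_eq)
  have "of_int w ^ (CARD('p) - 1) + ?p * C \<notin> reduction_ideal \<phi>"
  proof
    assume "of_int w ^ (CARD('p) - 1) + ?p * C \<in> reduction_ideal \<phi>"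
    moreover have "reduce (?p * C) = (0 :: 'p mod_ring poly)" by (simp add: reduce_eq_0_iff)
    ultimately have "\<phi> dvd of_int (w ^ (CARD('p) - 1))"
      by (simp add: in_reduction_ideal_iff hom_distribs)
    hence "int CARD('p) dvd w ^ (CARD('p) - 1)" using reduce_irreducible_dvd_const[OF irr(1)] by blast
    thus False using w prime_card_int[where 'a='p] prime_dvd_power by blast
  qed
  thus ?thesis using regular_at_ramified[OF irr(1) \<Phi> G(1) A'] by blast
qed

text \<open>Modulo \<Phi> the element X is m plus a multiple of p, and for t > 0 the p^t-th power
  removes that multiple modulo p^2. Thus G is congruent to m^(p^t) - m_0 modulo (\<Phi>, p^2), and p
  divides this number exactly once.\<close>

lemma regular_at_binomial:
  fixes \<phi> :: "'p::prime_card mod_ring poly"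
  assumes irr: "irreducible \<phi>" "monic \<phi>" and t: "t > 0"
    and X: "X - of_int m \<in> reduction_ideal \<phi>" and G: "monic G" "G = X ^ (CARD('p) ^ t) - of_int m0"
    and m0: "int CARD('p) dvd m ^ (CARD('p) ^ t) - m0" "\<not> int CARD('p) ^ 2 dvd m ^ (CARD('p) ^ t) - m0"
  shows "regular_at \<phi> G"
proof -
  let ?p = "of_nat CARD('p) :: int poly"
  obtain \<Phi> where \<Phi>: "reduce \<Phi> = \<phi>" "monic \<Phi>" using exists_monic_lift[OF irr(2)] by metis
  obtain A B where AB: "X - of_int m = \<Phi> * A + ?p * B"
    using X reduction_ideal_iff_generated[OF \<Phi>(1)] by blast
  define X0 where "X0 = of_int m + ?p * B"
  obtain \<kappa> where \<kappa>: "m ^ (CARD('p) ^ t) - m0 = int CARD('p) * \<kappa>" using m0(1) by (elim dvdE)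
  have \<kappa>': "\<not> int CARD('p) dvd \<kappa>" using m0(2) unfolding \<kappa> by (auto simp: power2_eq_square)
  have "?p ^ Suc 0 dvd X0 - of_int m" by (simp add: X0_def)
  from dvd_power_prime_power_diff[OF this, of t]
  have "?p ^ (1 + t) dvd X0 ^ (CARD('p) ^ t) - of_int m ^ (CARD('p) ^ t)" by simp
  moreover have "?p ^ 2 dvd ?p ^ (1 + t)" using t by (intro le_imp_power_dvd) auto
  ultimately have "?p ^ 2 dvd X0 ^ (CARD('p) ^ t) - of_int m ^ (CARD('p) ^ t)" by (rule dvd_trans[rotated])
  then obtain C where C: "X0 ^ (CARD('p) ^ t) - of_int m ^ (CARD('p) ^ t) = ?p ^ 2 * C" by (elim dvdE)
  have "\<Phi> dvd X - X0" using AB by (simp add: X0_def algebra_simps)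
  hence "\<Phi> dvd X ^ (CARD('p) ^ t) - X0 ^ (CARD('p) ^ t)" by (metis dvd_mult2 power_diff_sumr2)
  then obtain A' where A': "X ^ (CARD('p) ^ t) - X0 ^ (CARD('p) ^ t) = \<Phi> * A'" by (elim dvdE)
  have "G = \<Phi> * A' + ?p ^ 2 * C + of_int (m ^ (CARD('p) ^ t) - m0)"
    unfolding A'[symmetric] C[symmetric] G by simp
  hence G': "G = \<Phi> * A' + ?p * (of_int \<kappa> + ?p * C)"
    unfolding \<kappa> by (simp add: algebra_simps power2_eq_square)
  have "of_int \<kappa> + ?p * C \<notin> reduction_ideal \<phi>"
  proof
    assume "of_int \<kappa> + ?p * C \<in> reduction_ideal \<phi>"
    moreover have "reduce (?p * C) = (0 :: 'p mod_ring poly)" by (simp add: reduce_eq_0_iff)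
    ultimately have "\<phi> dvd of_int \<kappa>" by (simp add: in_reduction_ideal_iff hom_distribs)
    thus False using \<kappa>' reduce_irreducible_dvd_const[OF irr(1)] by blast
  qed
  thus ?thesis using regular_at_ramified[OF irr(1) \<Phi> G(1) G'] by blast
qed

text \<open>A double factor \<phi> would divide the derivative u x^(u-1), hence x^u because p does
  not divide u, hence the constant m.\<close>

lemma regular_at_separable:
  fixes \<phi> :: "'p::prime_card mod_ring poly"
  assumes irr: "irreducible \<phi>" and u: "u > 0" and um: "\<not> int CARD('p) dvd int u" "\<not> int CARD('p) dvd m"
    and G: "monom 1 u - of_int m \<in> reduction_ideal \<phi>"
  shows "regular_at \<phi> (monom 1 u - of_int m)"
proof -
  let ?G = "monom 1 u - of_int m :: 'p mod_ring poly"
  have prime: "prime_elem \<phi>" using irr by (rule irreducible_imp_prime_elem)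
  have red: "reduce (monom 1 u - of_int m) = ?G" by (simp add: hom_distribs)
  with G have "\<phi> dvd ?G" by (simp add: in_reduction_ideal_iff)
  then obtain \<psi> where \<psi>: "?G = \<phi> * \<psi>" by (elim dvdE)
  have "\<not> \<phi> dvd \<psi>"
  proof
    assume "\<phi> dvd \<psi>"
    hence "\<phi> dvd pderiv ?G" unfolding \<psi> by (simp add: pderiv_mult)
    hence "\<phi> dvd monom (of_nat u) (u - 1)" by (simp add: pderiv_diff pderiv_monom of_int_poly)
    also have "(monom (of_nat u) (u - 1) :: 'p mod_ring poly) = of_int (int u) * monom 1 (u - 1)"
      by (simp add: of_nat_poly smult_monom)
    finally have "\<phi> dvd of_int (int u) \<or> \<phi> dvd monom 1 (u - 1)"
      using prime prime_elem_dvd_multD by blast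
    hence "\<phi> dvd monom 1 (u - 1)" using um(1) reduce_irreducible_dvd_const[OF irr] by blast
    hence "\<phi> dvd monom 1 1 * monom 1 (u - 1)" by (rule dvd_mult)
    also have "(monom 1 1 * monom 1 (u - 1) :: 'p mod_ring poly) = monom 1 u" using u by (simp add: mult_monom)
    finally have "\<phi> dvd monom 1 u - ?G" using \<open>\<phi> dvd ?G\<close> by (rule dvd_diff)
    hence "\<phi> dvd of_int m" by simp
    thus False using um(2) reduce_irreducible_dvd_const[OF irr] by blast
  qed
  thus ?thesis using regular_at_unramified[OF irr _ \<open>\<not> \<phi> dvd \<psi>\<close>] red \<psi> by metis
qed

section \<open>Algebraic integers\<close>

text \<open>The determinant trick: x is an eigenvalue of the integer matrix A with eigenvector v,
  nonzero thanks to \<open>i0\<close>, so it is a root of a monic integer characteristic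
  polynomial.\<close>

lemma algebraic_int_of_stable_span:
  fixes v :: "nat \<Rightarrow> complex" and A :: "nat \<Rightarrow> nat \<Rightarrow> int"
  assumes "i0 < l" "v i0 \<noteq> 0"
    and A: "\<And>i. i < l \<Longrightarrow> x * v i = (\<Sum>j<l. of_int (A i j) * v j)"
  shows "algebraic_int x"
proof -
  define B where "B = mat l l (\<lambda>(i, j). A i j)"
  define C :: "complex mat" where "C = map_mat of_int B"
  have B: "B \<in> carrier_mat l l" and C: "C \<in> carrier_mat l l" by (auto simp: B_def C_def)
  have "eigenvector C (vec l v) x"
    unfolding eigenvector_def
  proof (intro conjI)
    show "vec l v \<in> carrier_vec (dim_row C)" using C by auto
    show "vec l v \<noteq> 0\<^sub>v (dim_row C)"
    proof
      assume "vec l v = 0\<^sub>v (dim_row C)"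
      hence "vec l v $ i0 = 0\<^sub>v (dim_row C) $ i0" by (rule arg_cong)
      thus False using assms(1,2) C by simp
    qed
    show "C *\<^sub>v vec l v = x \<cdot>\<^sub>v vec l v"
    proof (rule eq_vecI)
      fix i assume "i < dim_vec (x \<cdot>\<^sub>v vec l v)"
      hence i: "i < l" by simp
      thus "(C *\<^sub>v vec l v) $ i = (x \<cdot>\<^sub>v vec l v) $ i"
        using A[OF i] by (simp add: C_def B_def scalar_prod_def atLeast0LessThan)
    qed (use C in auto)
  qed
  hence "eigenvalue C x" unfolding eigenvalue_def by blast
  hence "poly (char_poly C) x = 0" using eigenvalue_root_char_poly[OF C] by blast
  also have "char_poly C = map_poly of_int (char_poly B)"
    unfolding C_def by (rule of_int_hom.char_poly_hom[OF B])
  finally show ?thesis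
    using degree_monic_char_poly[OF B] by (auto simp: algebraic_int_altdef_ipoly intro!: exI[of _ "char_poly B"])
qed

text \<open>Integrality over Z[\<alpha>] by a monic quadratic gives integrality over Z. The shape of
  the equation is the one that the separators satisfy.\<close>

lemma algebraic_int_quadratic:
  fixes x \<alpha> :: complex
  assumes n: "n > 0" and \<alpha>: "\<alpha> ^ n = of_int m"
    and x: "x ^ 2 = of_int \<mu> * x + poly (map_poly of_int q) \<alpha>"
  shows "algebraic_int x"
proof -
  \<comment> \<open>Spans Z[\<alpha>] + x Z[\<alpha>], which is stable under x: \<open>x ^ 2\<close>
    is rewritten by the quadratic and high powers of \<alpha> by
    \<open>\<alpha> ^ n = m\<close>.\<close>
  define v where "v i = (if i < n then \<alpha> ^ i else x * \<alpha> ^ (i - n))" for i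
  define S where "S = {y. \<exists>c::nat \<Rightarrow> int. y = (\<Sum>j<2*n. of_int (c j) * v j)}"
  have S_add: "y + z \<in> S" if yz: "y \<in> S" "z \<in> S" for y z
  proof -
    obtain c c' where "y = (\<Sum>j<2*n. of_int (c j) * v j)" "z = (\<Sum>j<2*n. of_int (c' j) * v j)"
      using yz unfolding S_def by blast
    hence "y + z = (\<Sum>j<2*n. of_int (c j + c' j) * v j)" by (simp add: sum.distrib algebra_simps)
    thus ?thesis unfolding S_def by (intro CollectI exI)
  qed
  have S_scale: "of_int k * y \<in> S" if y: "y \<in> S" for k y
  proof -
    obtain c where "y = (\<Sum>j<2*n. of_int (c j) * v j)" using y unfolding S_def by blast
    hence "of_int k * y = (\<Sum>j<2*n. of_int (k * c j) * v j)" by (simp add: sum_distrib_left algebra_simps)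
    thus ?thesis unfolding S_def by (intro CollectI exI)
  qed
  have S_v: "v i \<in> S" if i: "i < 2 * n" for i
  proof -
    have "v i = (\<Sum>j<2*n. of_int (if j = i then 1 else 0) * v j)"
      using i by (simp add: if_distrib[of of_int] if_distrib[of "\<lambda>x. x * _"] sum.delta cong: if_cong)
    thus ?thesis unfolding S_def by (intro CollectI exI)
  qed
  have S_0: "0 \<in> S" using S_scale[OF S_v[of 0], of 0] n by simp
  have S_sum: "sum f I \<in> S" if "\<And>i. i \<in> I \<Longrightarrow> f i \<in> S" for f and I :: "nat set"
    using that by (induction I rule: infinite_finite_induct) (auto simp: S_0 S_add)
  have S_pow: "\<alpha> ^ j \<in> S" for j
  proof -
    have "\<alpha> ^ j = \<alpha> ^ (n * (j div n) + j mod n)" by simp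
    also have "\<dots> = of_int (m ^ (j div n)) * v (j mod n)"
      using n by (simp only: power_add power_mult \<alpha>) (simp add: v_def)
    also have "\<dots> \<in> S" using mod_less_divisor[OF n, of j] by (intro S_scale S_v) simp
    finally show ?thesis .
  qed
  have "\<exists>c::nat \<Rightarrow> int. x * v i = (\<Sum>j<2*n. of_int (c j) * v j)" if i: "i < 2 * n" for i
  proof (cases "i < n")
    case True
    hence "x * v i = v (i + n)" by (simp add: v_def)
    also have "\<dots> \<in> S" using True by (intro S_v) simp
    finally show ?thesis by (simp add: S_def)
  next
    case False
    have "x * v i = x ^ 2 * \<alpha> ^ (i - n)" using False by (simp add: v_def power2_eq_square)
    also have "\<dots> = of_int \<mu> * v i + (\<Sum>j\<le>degree q. of_int (coeff q j) * \<alpha> ^ (j + (i - n)))"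
    proof -
      have "poly (map_poly of_int q) \<alpha> * \<alpha> ^ (i - n) = (\<Sum>j\<le>degree q. of_int (coeff q j) * \<alpha> ^ (j + (i - n)))"
        by (simp add: poly_altdef coeff_map_poly sum_distrib_right power_add mult.assoc)
      thus ?thesis unfolding x using False by (simp add: v_def distrib_right)
    qed
    also have "\<dots> \<in> S" using i by (intro S_add S_scale S_v S_sum S_pow)
    finally show ?thesis by (simp add: S_def)
  qed
  then obtain A :: "nat \<Rightarrow> nat \<Rightarrow> int" where
    "\<And>i. i < 2 * n \<Longrightarrow> x * v i = (\<Sum>j<2*n. of_int (A i j) * v j)" by metis
  moreover have "v 0 \<noteq> 0" using n by (simp add: v_def)
  ultimately show ?thesis using n by (intro algebraic_int_of_stable_span[of 0 "2 * n" v x A]) auto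
qed

lemma rat_poly_clear_denominator:
  fixes q :: "rat poly"
  shows "\<exists>L b. L > 0 \<and> map_poly of_int b = smult (of_int L) q"
proof (induction q)
  case 0
  show ?case by (intro exI[of _ 1] exI[of _ 0]) simp
next
  case (pCons a q)
  then obtain L b where Lb: "L > 0" "map_poly of_int b = smult (of_int L) q" by blast
  obtain c d where cd: "a = of_int c / of_int d" "d > 0"
    by (metis quotient_of_denom_pos quotient_of_div surj_pair)
  have "map_poly of_int (pCons (c * L) (smult d b)) = smult (of_int (d * L)) (pCons a q)"
    using cd Lb by (simp add: hom_distribs)
  moreover have "d * L > 0" using cd Lb by simp
  ultimately show ?case by blast
qed

lemma map_poly_of_rat_of_int:
  "map_poly (of_rat :: rat \<Rightarrow> complex) (map_poly of_int b) = map_poly of_int b"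
  by (subst map_poly_map_poly) (auto simp: o_def)

lemma num_field_clear_denominator:
  assumes "x \<in> num_field \<alpha>"
  obtains L b where "L > 0" "of_int L * x = poly (map_poly of_int b) \<alpha>"
proof -
  obtain q :: "rat poly" where q: "x = poly (map_poly of_rat q) \<alpha>"
    using assms unfolding num_field_def by blast
  obtain L b where Lb: "L > 0" "map_poly of_int b = smult (of_int L) q"
    using rat_poly_clear_denominator by blast
  have "poly (map_poly of_int b) \<alpha> = poly (map_poly of_rat (smult (of_int L) q)) \<alpha>"
    by (simp flip: Lb(2) add: map_poly_of_rat_of_int)
  also have "\<dots> = of_int L * x" by (simp add: q hom_distribs)
  finally show ?thesis using that Lb(1) by metis
qed

text \<open>Irreducibility gives divisibility over Q by Bezout. Since F is monic, division with
  remainder works over Z, and the remainder, a rational multiple of F of smaller degree, must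
  vanish.\<close>

lemma dvd_of_common_root:
  fixes F P :: "int poly" and \<alpha> :: complex
  assumes irr: "irreducible (map_poly of_int F :: rat poly)" and "monic F"
    and F: "poly (map_poly of_int F) \<alpha> = 0" and P: "poly (map_poly of_int P) \<alpha> = 0"
  shows "F dvd P"
proof -
  interpret h: map_poly_comm_ring_hom "of_rat :: rat \<Rightarrow> complex" ..
  let ?ev = "\<lambda>f::rat poly. poly (map_poly of_rat f) \<alpha>"
  have "(map_poly of_int F :: rat poly) dvd map_poly of_int P"
  proof (rule ccontr)
    assume "\<not> (map_poly of_int F :: rat poly) dvd map_poly of_int P"
    hence "coprime (map_poly of_int F) (map_poly of_int P :: rat poly)"
      using prime_elem_imp_coprime[OF irreducible_imp_prime_elem[OF irr]] by blast
    then obtain s t :: "rat poly" where st: "s * map_poly of_int F + t * map_poly of_int P = 1"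
      by (metis bezout_coefficients_fst_snd coprime_iff_gcd_eq_1)
    have "?ev (s * map_poly of_int F + t * map_poly of_int P) = 0"
      using F P by (simp add: h.hom_add h.hom_mult map_poly_of_rat_of_int)
    thus False unfolding st by simp
  qed
  then obtain q :: "rat poly" where q: "map_poly of_int P = map_poly of_int F * q" by (elim dvdE)
  have Fn: "F \<noteq> 0" using \<open>monic F\<close> by auto
  obtain Q R where QR: "pseudo_divmod P F = (Q, R)" by fastforce
  have PQ: "P = F * Q + R" "R = 0 \<or> degree R < degree F"
    using pseudo_divmod[OF Fn QR] \<open>monic F\<close> by auto
  have "R = 0"
  proof (rule ccontr)
    assume "R \<noteq> 0"
    have "map_poly of_int R = map_poly of_int F * (q - map_poly of_int Q)"
      using q unfolding PQ(1) by (simp add: hom_distribs algebra_simps)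
    moreover have "map_poly of_int R \<noteq> (0 :: rat poly)" using \<open>R \<noteq> 0\<close> by simp
    ultimately have "degree (map_poly of_int F :: rat poly) \<le> degree (map_poly of_int R :: rat poly)"
      by (metis dvd_triv_left dvd_imp_degree_le)
    thus False using PQ(2) \<open>R \<noteq> 0\<close> by simp
  qed
  thus ?thesis using PQ(1) by simp
qed

section \<open>Homogenised cyclotomic factors\<close>

text \<open>For i > 0 this is the quotient of Z^(p^i) - w^(p^i) by Z^(p^(i-1)) - w^(p^(i-1)),
  written out so that it makes sense in any commutative ring.\<close>

definition tower_factor :: "nat \<Rightarrow> 'a::comm_ring_1 \<Rightarrow> 'a \<Rightarrow> nat \<Rightarrow> 'a" where
  "tower_factor p Z w i = (if i = 0 then Z - w
     else \<Sum>j<p. (Z ^ p ^ (i - 1)) ^ j * (w ^ p ^ (i - 1)) ^ (p - Suc j))"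

lemma prod_tower_factor:
  "(\<Prod>i\<le>j. tower_factor p Z w i) = Z ^ p ^ j - w ^ p ^ j"
proof (induction j)
  case 0
  show ?case by (simp add: tower_factor_def)
next
  case (Suc j)
  have "(\<Prod>i\<le>Suc j. tower_factor p Z w i) =
      (Z ^ p ^ j - w ^ p ^ j) * (\<Sum>i<p. (Z ^ p ^ j) ^ i * (w ^ p ^ j) ^ (p - Suc i))"
    by (simp add: Suc.IH) (simp add: tower_factor_def)
  also have "\<dots> = (Z ^ p ^ j) ^ p - (w ^ p ^ j) ^ p"
    by (subst power_diff_sumr2) (simp add: mult.commute)
  finally show ?case by (simp add: mult.commute flip: power_mult)
qed

text \<open>The lower factors multiply to a divisor of Z^(p^(l-1)) - w^(p^(l-1)); modulo it all p
  summands of the l-th factor become the same power of w.\<close>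

lemma tower_factor_cong:
  assumes "j < l" "p > 0"
  shows "(\<Prod>i\<le>j. tower_factor p Z w i) dvd tower_factor p Z w l - of_nat p * w ^ ((p - 1) * p ^ (l - 1))"
proof -
  let ?Z = "Z ^ p ^ (l - 1)" and ?w = "w ^ p ^ (l - 1)"
  have "(\<Prod>i\<le>l - 1. tower_factor p Z w i) = ?Z - ?w" by (rule prod_tower_factor)
  moreover have "(\<Prod>i\<le>j. tower_factor p Z w i) dvd (\<Prod>i\<le>l - 1. tower_factor p Z w i)"
    using assms by (intro prod_dvd_prod_subset) auto
  ultimately have 1: "(\<Prod>i\<le>j. tower_factor p Z w i) dvd ?Z - ?w" by simp
  have "?Z - ?w dvd ?Z ^ i - ?w ^ i" for i by (metis dvd_triv_left power_diff_sumr2)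
  hence "(\<Prod>i\<le>j. tower_factor p Z w i) dvd (\<Sum>i<p. (?Z ^ i - ?w ^ i) * ?w ^ (p - Suc i))"
    by (intro dvd_sum dvd_mult2 dvd_trans[OF 1])
  also have "(\<Sum>i<p. (?Z ^ i - ?w ^ i) * ?w ^ (p - Suc i)) =
      (\<Sum>i<p. ?Z ^ i * ?w ^ (p - Suc i)) - (\<Sum>i<p. ?w ^ (p - 1))"
    unfolding sum_subtractf[symmetric]
    by (intro sum.cong refl) (auto simp: left_diff_distrib simp flip: power_add)
  also have "(\<Sum>i<p. ?Z ^ i * ?w ^ (p - Suc i)) = tower_factor p Z w l"
    using assms by (simp add: tower_factor_def)
  finally show ?thesis by (simp add: mult.commute flip: power_mult)
qed

lemma prod_dvd_diff:
  fixes f g :: "'b \<Rightarrow> 'a::comm_ring_1"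
  assumes "\<And>i. i \<in> A \<Longrightarrow> H dvd f i - g i"
  shows "H dvd prod f A - prod g A"
  using assms
proof (induction A rule: infinite_finite_induct)
  case (insert x A)
  have "H dvd f x * (prod f A - prod g A) + (f x - g x) * prod g A"
    using insert by (intro dvd_add dvd_mult dvd_mult2) auto
  thus ?case using insert by (simp add: algebra_simps)
qed auto

text \<open>Origin of the denominators p^(s-j): each of the s - j upper factors contributes one p.
  The exponent K may stay implicit, since w will be prime to p and only its powers matter.\<close>

lemma prod_upper_tower_factor_cong:
  assumes "p > 0"
  shows "\<exists>K. (\<Prod>i\<le>j. tower_factor p Z w i) dvd (\<Prod>l\<in>{j<..s}. tower_factor p Z w l) - of_nat p ^ (s - j) * w ^ K"
proof -
  have "(\<Prod>i\<le>j. tower_factor p Z w i) dvd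
      (\<Prod>l\<in>{j<..s}. tower_factor p Z w l) - (\<Prod>l\<in>{j<..s}. of_nat p * w ^ ((p - 1) * p ^ (l - 1)))"
    using assms by (intro prod_dvd_diff tower_factor_cong) auto
  thus ?thesis by (auto simp: prod.distrib simp flip: power_sum)
qed

section \<open>Residues\<close>

lemma prime_dvd_power_minus_one:
  fixes x :: int
  assumes "prime p" "\<not> int p dvd x"
  shows "int p dvd x ^ (p - 1) - 1"
proof -
  define y where "y = nat (x mod int p)"
  have p: "p > 0" using assms(1) by (simp add: prime_gt_0_nat)
  have y: "[int y = x] (mod int p)" using p by (simp add: y_def cong_def)
  have "\<not> p dvd y" using y assms(2) by (metis cong_dvd_iff int_dvd_int_iff cong_def dvd_eq_mod_eq_0)
  hence "[y ^ (p - 1) = 1] (mod p)" using fermat_theorem assms(1) by blast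
  hence "[int y ^ (p - 1) = 1] (mod int p)" by (metis cong_int_iff of_nat_1 of_nat_power)
  moreover have "[int y ^ (p - 1) = x ^ (p - 1)] (mod int p)" using y by (rule cong_pow)
  ultimately have "[x ^ (p - 1) = 1] (mod int p)" by (metis cong_sym cong_trans)
  thus ?thesis by (simp add: cong_iff_dvd_diff)
qed

lemma prime_dvd_power_prime_power_diff:
  fixes x :: int
  assumes "prime p"
  shows "int p dvd x ^ p ^ j - x"
proof (induction j)
  case (Suc j)
  have p: "p > 0" using assms by (simp add: prime_gt_0_nat)
  have 1: "int p dvd y ^ p - y" for y
  proof (cases "int p dvd y")
    case True
    thus ?thesis using dvd_trans[OF True dvd_power[of p y]] p by (intro dvd_diff) auto
  next
    case False
    have "int p dvd y * (y ^ (p - 1) - 1)" using prime_dvd_power_minus_one[OF assms False] by (rule dvd_mult)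
    also have "\<dots> = y ^ p - y" using p by (simp add: right_diff_distrib power_eq_if)
    finally show ?thesis .
  qed
  have "int p dvd ((x ^ p ^ j) ^ p - x ^ p ^ j) + (x ^ p ^ j - x)" using 1 Suc.IH by (intro dvd_add)
  thus ?case by (simp add: mult.commute flip: power_mult)
qed simp

text \<open>Maximality of s enters here. As m^(p^t) is a p-th power, its (p-1)-st power is 1 modulo
  p^2; if m_0 agreed with it modulo p^2, raising to the p^s-th power would make m^(p-1) equal to 1
  modulo p^(s+2).\<close>

lemma root_not_congruent_mod_square:
  fixes m m0 :: int
  assumes p: "prime p" and m: "\<not> int p dvd m" and t: "t > 0" and N: "N \<ge> s + 2"
    and m0: "int p ^ N dvd m0 ^ p ^ s - m" and "\<not> int p ^ (s + 2) dvd m ^ (p - 1) - 1"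
  shows "\<not> int p ^ 2 dvd m ^ p ^ t - m0"
proof
  assume A: "int p ^ 2 dvd m ^ p ^ t - m0"
  define y where "y = m ^ p ^ (t - 1)"
  have yp: "y ^ p = m ^ p ^ t" using t by (cases t) (auto simp: y_def mult.commute simp flip: power_mult)
  have "\<not> int p dvd y"
    using m p unfolding y_def by (metis prime_dvd_power prime_nat_int_transfer)
  hence "int p dvd y ^ (p - 1) - 1" using p prime_dvd_power_minus_one by blast
  hence "int p ^ (Suc 0 + 1) dvd (y ^ (p - 1)) ^ p ^ 1 - 1 ^ p ^ 1"
    by (intro dvd_power_prime_power_diff) simp
  hence 1: "int p ^ 2 dvd (y ^ p) ^ (p - 1) - 1"
    by (simp add: numeral_2_eq_2 mult.commute flip: power_mult)
  have "y ^ p - m0 dvd (y ^ p) ^ (p - 1) - m0 ^ (p - 1)" by (metis dvd_triv_left power_diff_sumr2)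
  hence "int p ^ 2 dvd (y ^ p) ^ (p - 1) - m0 ^ (p - 1)" using A dvd_trans unfolding yp by blast
  from dvd_diff[OF 1 this] have "int p ^ Suc 1 dvd m0 ^ (p - 1) - 1" by (simp add: numeral_2_eq_2)
  from dvd_power_prime_power_diff[OF this, of s]
  have 2: "int p ^ (s + 2) dvd (m0 ^ p ^ s) ^ (p - 1) - 1" by (simp add: mult.commute flip: power_mult)
  have "int p ^ (s + 2) dvd m0 ^ p ^ s - m" using m0 N by (metis dvd_trans le_imp_power_dvd)
  moreover have "m0 ^ p ^ s - m dvd (m0 ^ p ^ s) ^ (p - 1) - m ^ (p - 1)" by (metis dvd_triv_left power_diff_sumr2)
  ultimately have "int p ^ (s + 2) dvd (m0 ^ p ^ s) ^ (p - 1) - m ^ (p - 1)" by (rule dvd_trans)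
  from dvd_diff[OF 2 this] show False using assms(6) by simp
qed

lemma poly_eq_sum_lessThan:
  fixes f :: "'a::comm_ring_1 poly"
  assumes "\<forall>i\<ge>k. coeff f i = 0"
  shows "poly f x = (\<Sum>i<k. coeff f i * x ^ i)"
proof -
  have "poly f x = (\<Sum>i<max k (Suc (degree f)). coeff f i * x ^ i)"
    unfolding poly_altdef by (rule sum.mono_neutral_left) (auto simp: coeff_eq_0)
  also have "\<dots> = (\<Sum>i<k. coeff f i * x ^ i)"
    using assms by (intro sum.mono_neutral_right) auto
  finally show ?thesis .
qed

lemma pcompose_eq_sum_lessThan:
  fixes f :: "int poly"
  assumes "\<forall>i\<ge>k. coeff f i = 0"
  shows "f \<circ>\<^sub>p x = (\<Sum>i<k. of_int (coeff f i) * x ^ i)"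
  unfolding pcompose_altdef
  by (subst poly_eq_sum_lessThan[of k]) (use assms in \<open>auto simp: coeff_map_poly of_int_poly\<close>)

lemma diff_dvd_pcompose_diff:
  fixes a b w :: "'a::comm_ring_1 poly"
  shows "a - b dvd w \<circ>\<^sub>p a - w \<circ>\<^sub>p b"
proof (induction w)
  case (pCons c w)
  have "pCons c w \<circ>\<^sub>p a - pCons c w \<circ>\<^sub>p b = (a - b) * (w \<circ>\<^sub>p a) + b * (w \<circ>\<^sub>p a - w \<circ>\<^sub>p b)"
    by (simp add: pcompose_pCons algebra_simps)
  thus ?case using pCons.IH by simp
qed simp

text \<open>The hypotheses \<open>root\<close> and \<open>approx\<close> say that \<open>G\<close> divides a polynomial congruent modulo
  $p^N$ to the minimal polynomial of $\alpha$; the element $\tau$ represents the residue of $\theta$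
  at the prime given by $\phi$ and \<open>G\<close>.\<close>
lemma exists_residue:
  fixes \<phi> :: "'p::prime_card mod_ring poly" and \<alpha> \<theta> :: complex
  assumes irr: "irreducible \<phi>" and reg: "regular_at \<phi> G"
    and root: "\<And>P. poly (map_poly of_int P) \<alpha> = 0 \<Longrightarrow> F dvd P"
    and approx: "of_nat CARD('p) ^ N dvd F - Gt" "G dvd Gt"
    and L: "L = int CARD('p) ^ c * D" "\<not> int CARD('p) dvd D"
    and \<theta>: "of_int L * \<theta> = poly (map_poly of_int b) \<alpha>"
    and T: "monic T" "poly (map_poly of_int T) \<theta> = 0"
    and N: "c * degree T \<le> N" "c * k + s < N"
  shows "\<exists>\<tau>. \<forall>f l g \<gamma>. l \<le> s \<longrightarrow> (\<forall>i\<ge>k. coeff f i = 0) \<longrightarrow>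
    of_nat CARD('p) ^ l * poly (map_poly of_int f) \<theta> = poly (map_poly of_int g) \<alpha> \<longrightarrow>
    G dvd g - of_nat CARD('p) ^ l * \<gamma> \<longrightarrow> f \<circ>\<^sub>p \<tau> - \<gamma> \<in> reduction_ideal \<phi>"
proof -
  let ?p = "of_nat CARD('p) :: int poly"
  let ?M = "reduction_ideal \<phi>"
  let ?L = "of_int L :: int poly"
  obtain \<pi> e where par: "prime_ideal_with_parameter ?M G \<pi>" "e > 0"
    "prime_ideal_with_parameter.exact_order ?M G \<pi> e ?p"
    using reg unfolding regular_at_def by blast
  interpret prime_ideal_with_parameter ?M G \<pi> by (rule par(1))
  have D: "of_int D \<notin> ?M"
    using L(2) reduce_irreducible_dvd_const[OF irr] by (simp add: in_reduction_ideal_iff hom_distribs)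
  have L': "?L = ?p ^ c * of_int D" by (simp add: L(1))
  \<comment> \<open>The transfer from \<alpha> to Z[x]/(G): a polynomial vanishing at \<alpha> is a
    multiple of F, which is a multiple of G up to \<open>p ^ N\<close>.\<close>
  have small: "P \<in> J (e * N)" if P: "poly (map_poly of_int P) \<alpha> = 0" for P
  proof -
    obtain Q where Q: "P = F * Q" using root[OF P] by (elim dvdE)
    obtain \<kappa> where \<kappa>: "F - Gt = ?p ^ N * \<kappa>" using approx(1) by (elim dvdE)
    have "P = Gt * Q + (F - Gt) * Q" by (simp add: Q algebra_simps)
    also have "\<dots> = Gt * Q + (\<kappa> * Q) * ?p ^ N" unfolding \<kappa> by (simp add: algebra_simps)
    also have "\<dots> \<in> J (e * N)"
      using exact_order_power[OF par(3), of N] approx(2)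
      by (intro J_add[OF G_dvd_in_J J_scale]) (auto simp: exact_order_def)
    finally show ?thesis .
  qed
  have hom: "poly (map_poly of_int (\<Sum>i<k. of_int (f i) * b ^ i * ?L ^ (k - i))) \<alpha>
      = of_int L ^ k * (\<Sum>i<k. of_int (f i) * \<theta> ^ i)" for f :: "nat \<Rightarrow> int" and k
  proof -
    have "poly (map_poly of_int (\<Sum>i<k. of_int (f i) * b ^ i * ?L ^ (k - i))) \<alpha>
      = (\<Sum>i<k. of_int (f i) * (of_int L * \<theta>) ^ i * of_int L ^ (k - i))"
      unfolding \<theta> by (simp add: hom_distribs poly_sum)
    also have "\<dots> = (\<Sum>i<k. of_int L ^ k * (of_int (f i) * \<theta> ^ i))"
    proof (intro sum.cong refl)
      fix i assume "i \<in> {..<k}"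
      hence "(of_int L :: complex) ^ k = of_int L ^ i * of_int L ^ (k - i)" by (simp flip: power_add)
      thus "of_int (f i) * (of_int L * \<theta>) ^ i * of_int L ^ (k - i) = of_int L ^ k * (of_int (f i) * \<theta> ^ i)"
        by (simp add: power_mult_distrib)
    qed
    finally show ?thesis by (simp add: sum_distrib_left)
  qed
  have "degree T > 0"
  proof (rule ccontr)
    assume "\<not> degree T > 0"
    hence "T = 1" using T(1) by (simp add: monic_degree_0)
    thus False using T(2) by simp
  qed
  \<comment> \<open>T homogenised by L is an integral equation for b/L that holds up to
    \<open>p ^ N\<close>, so b/L lies in the valuation ring.\<close>
  have "\<exists>a y. a \<notin> ?M \<and> G dvd a * b - ?L * y"
  proof (rule dvd_of_integral_equation[OF par(3,2) \<open>degree T > 0\<close> D L'])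
    let ?P = "b ^ degree T + (\<Sum>i<degree T. of_int (coeff T i) * b ^ i * ?L ^ (degree T - i))"
    have "poly (map_poly of_int T) \<theta> = \<theta> ^ degree T + (\<Sum>i<degree T. of_int (coeff T i) * \<theta> ^ i)"
      using T(1) by (simp add: poly_altdef coeff_map_poly flip: lessThan_Suc_atMost)
    hence "poly (map_poly of_int ?P) \<alpha> = of_int L ^ degree T * poly (map_poly of_int T) \<theta>"
      unfolding of_int_poly_hom.hom_add poly_add hom
      by (simp add: hom_distribs \<theta>[symmetric] power_mult_distrib algebra_simps)
    hence "?P \<in> J (e * N)" using T(2) by (intro small) simp
    thus "?P \<in> J (e * (c * degree T))" using mult_le_mono2[OF N(1)] by (rule J_mono[rotated])
  qed
  then obtain a y where a: "a \<notin> ?M" "G dvd a * b - ?L * y" by blast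
  \<comment> \<open>Scaling by an inverse of \<open>a\<close> in the residue field makes the
    multiplier 1 modulo M, so that \<open>g * y\<close> has the residue of b/L itself.\<close>
  obtain g where g: "a * g - 1 \<in> ?M" using reduction_ideal_invertible[OF irr a(1)] by blast
  have "G dvd g * (a * b - ?L * y)" using a(2) by (rule dvd_mult)
  hence a0: "G dvd (a * g) * b - ?L * (g * y)" by (simp add: algebra_simps)
  show ?thesis
  \<comment> \<open>The witness depends on \<theta> only, so one \<tau> serves all elements
    f(\<theta>) simultaneously.\<close>
  proof (intro exI[of _ "g * y"] allI impI)
    fix f l h \<gamma>
    assume l: "l \<le> s" and f: "\<forall>i\<ge>k. coeff f i = 0"
      and h: "of_nat CARD('p) ^ l * poly (map_poly of_int f) \<theta> = poly (map_poly of_int h) \<alpha>"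
      and \<gamma>: "G dvd h - ?p ^ l * \<gamma>"
    let ?P = "?p ^ l * (\<Sum>i<k. of_int (coeff f i) * b ^ i * ?L ^ (k - i)) - h * ?L ^ k"
    have "poly (map_poly of_int f) \<theta> = (\<Sum>i<k. of_int (coeff f i) * \<theta> ^ i)"
      using f by (subst poly_eq_sum_lessThan[of k]) (auto simp: coeff_map_poly)
    hence "poly (map_poly of_int ?P) \<alpha> = 0"
      unfolding of_int_poly_hom.hom_minus of_int_poly_hom.hom_mult poly_diff poly_mult hom h[symmetric]
      by (simp add: hom_distribs algebra_simps)
    hence P: "?P \<in> J (e * N)" by (rule small)
    have "c * k + l < N" using l N(2) by simp
    from residue_eq[OF par(3,2) D L' g a0 P this \<gamma>]
    show "f \<circ>\<^sub>p (g * y) - \<gamma> \<in> ?M" by (simp add: pcompose_eq_sum_lessThan[OF f])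
  qed
qed

section \<open>Minimal polynomials in finite residue fields\<close>

lemma finite_degree_less:
  "finite {f :: 'p::prime_card mod_ring poly. degree f < n}"
proof (rule finite_subset)
  show "{f :: 'p mod_ring poly. degree f < n} \<subseteq> Poly ` {xs. set xs \<subseteq> UNIV \<and> length xs \<le> n}"
  proof
    fix f :: "'p mod_ring poly" assume "f \<in> {f. degree f < n}"
    hence "length (coeffs f) \<le> n" by (cases "f = 0") (auto simp: length_coeffs)
    thus "f \<in> Poly ` {xs. set xs \<subseteq> UNIV \<and> length xs \<le> n}"
      by (intro image_eqI[of _ _ "coeffs f"]) auto
  qed
  show "finite (Poly ` {xs :: 'p mod_ring list. set xs \<subseteq> UNIV \<and> length xs \<le> n})"
    by (intro finite_imageI finite_lists_length_le) simp
qed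

lemma card_degree_less_strict_mono:
  assumes "0 < n" "n < n'"
  shows "card {f :: 'p::prime_card mod_ring poly. degree f < n} < card {f :: 'p mod_ring poly. degree f < n'}"
proof (intro psubset_card_mono finite_degree_less psubsetI)
  show "{f :: 'p mod_ring poly. degree f < n} \<noteq> {f. degree f < n'}"
  proof
    assume "{f :: 'p mod_ring poly. degree f < n} = {f. degree f < n'}"
    moreover have "monom 1 n \<in> {f :: 'p mod_ring poly. degree f < n'}" using assms by (simp add: degree_monom_eq)
    ultimately have "degree (monom 1 n :: 'p mod_ring poly) < n" by blast
    thus False by (simp add: degree_monom_eq)
  qed
qed (use assms in auto)

lemma degree_mod_irreducible_less:
  fixes g :: "'p::prime_card mod_ring poly"
  assumes "irreducible g"
  shows "degree (w mod g) < degree g"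
proof -
  have "g \<noteq> 0" "\<not> g dvd 1" using assms by (auto simp: irreducible_def)
  hence "degree g > 0" using is_unit_iff_degree by auto
  thus ?thesis using degree_mod_less[OF \<open>g \<noteq> 0\<close>, of w] by auto
qed

text \<open>Substituting \<tau> embeds F_p[x]/(f) into F_p[x]/(g); the polynomials of degree below
  \<open>degree f\<close> and \<open>degree g\<close> represent the classes.\<close>

lemma card_degree_less_le:
  fixes f g \<tau> :: "'p::prime_card mod_ring poly"
  assumes "irreducible g" "\<And>w. g dvd w \<circ>\<^sub>p \<tau> \<Longrightarrow> f dvd w"
  shows "card {w :: 'p mod_ring poly. degree w < degree f} \<le> card {w :: 'p mod_ring poly. degree w < degree g}"
proof (rule card_inj_on_le[OF _ _ finite_degree_less])
  show "inj_on (\<lambda>w. (w \<circ>\<^sub>p \<tau>) mod g) {w. degree w < degree f}"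
  proof (rule inj_onI, rule ccontr)
    fix v w assume vw: "v \<in> {w. degree w < degree f}" "w \<in> {w. degree w < degree f}"
      "(v \<circ>\<^sub>p \<tau>) mod g = (w \<circ>\<^sub>p \<tau>) mod g" "v \<noteq> w"
    hence "g dvd (v - w) \<circ>\<^sub>p \<tau>" by (simp add: pcompose_diff mod_eq_dvd_iff)
    hence "f dvd v - w" by (rule assms(2))
    hence "degree f \<le> degree (v - w)" using vw(4) by (intro dvd_imp_degree_le) auto
    moreover have "degree (v - w) < degree f" using vw by (intro degree_diff_less) auto
    ultimately show False by simp
  qed
  show "(\<lambda>w. (w \<circ>\<^sub>p \<tau>) mod g) ` {w. degree w < degree f} \<subseteq> {w. degree w < degree g}"
    using degree_mod_irreducible_less[OF assms(1)] by auto
qed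

text \<open>The polynomial g generates the kernel of evaluation at \<tau> in the field
  F_p[x]/(\<phi>), a prime ideal. Its degree is that of \<phi> because a(\<tau>) = x makes the
  evaluation onto.\<close>

lemma exists_residue_min_poly:
  fixes \<phi> \<tau> a :: "'p::prime_card mod_ring poly"
  assumes irr: "irreducible \<phi>" and a: "\<phi> dvd a \<circ>\<^sub>p \<tau> - [:0, 1:]"
  shows "\<exists>g. monic g \<and> irreducible g \<and> degree g = degree \<phi> \<and> (\<forall>w. g dvd w \<longleftrightarrow> \<phi> dvd w \<circ>\<^sub>p \<tau>)"
proof -
  have prime: "prime_elem \<phi>" using irr by (rule irreducible_imp_prime_elem)
  define I where "I = {w. \<phi> dvd w \<circ>\<^sub>p \<tau>}"
  have "\<exists>w. w \<noteq> 0 \<and> w \<in> I"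
  proof -
    \<comment> \<open>Pigeonhole: the powers of \<tau> repeat modulo \<phi>, so the kernel is
      nonzero.\<close>
    let ?h = "\<lambda>k. (monom 1 k \<circ>\<^sub>p \<tau>) mod \<phi>"
    have "range ?h \<subseteq> {w. degree w < degree \<phi>}"
      using degree_mod_irreducible_less[OF irr] by auto
    hence "finite (range ?h)" using finite_degree_less finite_subset by blast
    hence "\<not> inj ?h" using range_inj_infinite by blast
    then obtain i j where ij: "i \<noteq> j" "?h i = ?h j" unfolding inj_def by blast
    have "monom 1 i - monom 1 j \<in> I" using ij(2) by (simp add: I_def pcompose_diff mod_eq_dvd_iff)
    moreover have "monom 1 i - monom 1 j \<noteq> (0 :: 'p mod_ring poly)"
      using ij(1) by (metis degree_monom_eq eq_iff_diff_eq_0 one_neq_zero)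
    ultimately show ?thesis by blast
  qed
  then obtain g0 where g0: "g0 \<noteq> 0" "g0 \<in> I" "\<And>w. w \<noteq> 0 \<Longrightarrow> w \<in> I \<Longrightarrow> degree g0 \<le> degree w"
    using ex_has_least_nat[of "\<lambda>w. w \<noteq> 0 \<and> w \<in> I" _ degree] by blast
  have g0_iff: "g0 dvd w \<longleftrightarrow> w \<in> I" for w
  proof
    assume "g0 dvd w"
    thus "w \<in> I" using g0(2) by (auto simp: I_def pcompose_mult elim!: dvdE)
  next
    assume w: "w \<in> I"
    have "w mod g0 = w - g0 * (w div g0)" by (simp add: minus_mult_div_eq_mod)
    hence "w mod g0 \<in> I" using w g0(2) by (auto simp: I_def pcompose_mult pcompose_diff)
    hence "w mod g0 = 0" using g0(3)[of "w mod g0"] degree_mod_less[OF g0(1), of w] by fastforce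
    thus "g0 dvd w" by auto
  qed
  define g where "g = smult (inverse (lead_coeff g0)) g0"
  have g_iff: "g dvd w \<longleftrightarrow> \<phi> dvd w \<circ>\<^sub>p \<tau>" for w
    using g0_iff[of w] g0(1) by (simp add: g_def smult_dvd_iff I_def)
  have "monic g" using g0(1) by (simp add: g_def)
  have "prime_elem g"
  proof (rule prime_elemI)
    show "g \<noteq> 0" using \<open>monic g\<close> by auto
    show "\<not> g dvd 1" using irr unfolding g_iff pcompose_1 by (auto simp only: irreducible_def)
    show "g dvd v \<or> g dvd w" if "g dvd v * w" for v w
      using that prime_elem_dvd_multD[OF prime] by (auto simp: g_iff pcompose_mult)
  qed
  hence "irreducible g" by (rule prime_elem_imp_irreducible)
  \<comment> \<open>Substituting \<open>a\<close> thus embeds F_p[x]/(\<phi>) into F_p[x]/(g). With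
    the embedding in the other direction the two fields have equally many elements, which forces
    equal degrees.\<close>
  have "\<phi> dvd w" if "g dvd w \<circ>\<^sub>p a" for w
  proof -
    have "\<phi> dvd w \<circ>\<^sub>p (a \<circ>\<^sub>p \<tau>)" using that by (simp add: g_iff pcompose_assoc)
    moreover have "\<phi> dvd w \<circ>\<^sub>p (a \<circ>\<^sub>p \<tau>) - w \<circ>\<^sub>p [:0, 1:]"
      using a diff_dvd_pcompose_diff dvd_trans by blast
    ultimately have "\<phi> dvd w \<circ>\<^sub>p (a \<circ>\<^sub>p \<tau>) - (w \<circ>\<^sub>p (a \<circ>\<^sub>p \<tau>) - w \<circ>\<^sub>p [:0, 1:])"
      by (rule dvd_diff)
    thus ?thesis by simp
  qed
  hence 1: "card {w :: 'p mod_ring poly. degree w < degree \<phi>} \<le> card {w :: 'p mod_ring poly. degree w < degree g}"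
    by (rule card_degree_less_le[OF \<open>irreducible g\<close>])
  have 2: "card {w :: 'p mod_ring poly. degree w < degree g} \<le> card {w :: 'p mod_ring poly. degree w < degree \<phi>}"
    by (rule card_degree_less_le[OF irr]) (simp add: g_iff)
  have "degree \<phi> > 0" "degree g > 0"
    using degree_mod_irreducible_less[OF irr, of 0] degree_mod_irreducible_less[OF \<open>irreducible g\<close>, of 0] by auto
  hence "degree g = degree \<phi>"
    using 1 2 card_degree_less_strict_mono[where 'p='p] by (metis leD linorder_neqE_nat)
  thus ?thesis using \<open>monic g\<close> \<open>irreducible g\<close> g_iff by blast
qed

lemma monogenic_obtain_poly:
  assumes "\<forall>x\<in>R. \<exists>!c::nat \<Rightarrow> int. (\<forall>i\<ge>k. c i = 0) \<and> x = (\<Sum>i<k. of_int (c i) * \<theta> ^ i)"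
    and "x \<in> R"
  obtains f :: "int poly" where "\<forall>i\<ge>k. coeff f i = 0" "poly (map_poly of_int f) \<theta> = (x :: complex)"
proof -
  obtain c :: "nat \<Rightarrow> int" where c: "\<forall>i\<ge>k. c i = 0" "x = (\<Sum>i<k. of_int (c i) * \<theta> ^ i)"
    using assms by blast
  have coeff: "coeff (Poly (map c [0..<k])) i = c i" for i
    using c(1) by (simp add: nth_default_def)
  show ?thesis
  proof (rule that[of "Poly (map c [0..<k])"])
    show "\<forall>i\<ge>k. coeff (Poly (map c [0..<k])) i = 0" using c(1) coeff by simp
    hence "poly (map_poly of_int (Poly (map c [0..<k]))) \<theta> =
        (\<Sum>i<k. coeff (map_poly of_int (Poly (map c [0..<k]))) i * \<theta> ^ i)"
      by (intro poly_eq_sum_lessThan) (simp add: coeff_map_poly)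
    thus "poly (map_poly of_int (Poly (map c [0..<k]))) \<theta> = x"
      unfolding c(2) by (simp only: coeff_map_poly of_int_0 coeff)
  qed
qed

lemma poly_of_int_in_num_field:
  "poly (map_poly of_int f) \<alpha> / of_int L \<in> num_field \<alpha>"
proof -
  interpret h: map_poly_comm_ring_hom "of_rat :: rat \<Rightarrow> complex" ..
  have "map_poly of_rat (smult (inverse (of_int L)) (map_poly of_int f)) =
      smult (inverse (of_int L)) (map_poly of_int f :: complex poly)"
    by (simp add: map_poly_of_rat_of_int of_rat_inverse hom_distribs)
  hence "poly (map_poly of_int f) \<alpha> / of_int L =
      poly (map_poly of_rat (smult (inverse (of_int L)) (map_poly of_int f))) \<alpha>"
    by (simp add: divide_inverse)
  thus ?thesis unfolding num_field_def by blast
qed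

section \<open>The factors and separators attached to x^n - m\<close>

lemma monic_monom_diff: "k > 0 \<Longrightarrow> monic (monom 1 k - of_int c :: int poly)"
proof -
  assume "k > 0"
  hence "degree (- of_int c :: int poly) < degree (monom 1 k :: int poly)" by (simp add: degree_monom_eq)
  from degree_add_eq_left[OF this]
  have "degree (monom 1 k - of_int c :: int poly) = k" by (simp add: degree_monom_eq)
  moreover have "coeff (of_int c :: int poly) k = 0" using \<open>k > 0\<close> by (intro coeff_eq_0) simp
  ultimately show ?thesis by simp
qed

text \<open>Consecutive partial products are monic binomials, and leading coefficients
  multiply.\<close>

lemma monic_tower_factor:
  assumes "k > 0" "p > 0"
  shows "monic (tower_factor p (monom 1 k) (of_int w :: int poly) i)"
proof -
  let ?G = "tower_factor p (monom 1 k) (of_int w :: int poly)"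
  have monic: "monic (\<Prod>i\<le>j. ?G i)" for j
  proof -
    have eq: "(\<Prod>i\<le>j. ?G i) = monom 1 (k * p ^ j) - of_int (w ^ p ^ j)"
      by (simp add: prod_tower_factor monom_power)
    show ?thesis unfolding eq by (rule monic_monom_diff) (use assms in simp)
  qed
  show ?thesis
  proof (cases i)
    case 0
    thus ?thesis using monic[of 0] by simp
  next
    case (Suc j)
    have "lead_coeff (\<Prod>i\<le>Suc j. ?G i) = lead_coeff (\<Prod>i\<le>j. ?G i) * lead_coeff (?G (Suc j))"
      by (simp only: prod.atMost_Suc lead_coeff_mult)
    thus ?thesis using monic[of j] monic[of "Suc j"] Suc by simp
  qed
qed

text \<open>At \<phi> one has Z = m^(p^t) = m = m_0 in the residue field. The factor with i > 0 is
  then cyclotomic, and the factor i = 0 is a separable binomial for t = 0 and a ramified one for t >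
  0.\<close>

lemma regular_at_tower_factor:
  fixes \<phi> :: "'p::prime_card mod_ring poly" and m m0 :: int
  assumes irr: "irreducible \<phi>" "monic \<phi>" and odd: "odd CARD('p)" and u: "u > 0"
    and um: "\<not> int CARD('p) dvd int u" "\<not> int CARD('p) dvd m"
    and \<phi>: "\<phi> dvd monom 1 u - of_int m"
    and N: "N \<ge> s + 2" and m0: "int CARD('p) ^ N dvd m0 ^ CARD('p) ^ s - m"
    and t: "t = 0 \<or> \<not> int CARD('p) ^ (s + 2) dvd m ^ (CARD('p) - 1) - 1"
  shows "regular_at \<phi> (tower_factor CARD('p) (monom 1 (u * CARD('p) ^ t)) (of_int m0) i)"
proof -
  let ?p = "CARD('p)"
  let ?M = "reduction_ideal \<phi>"
  let ?Z = "monom 1 (u * ?p ^ t) :: int poly"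
  let ?G = "tower_factor ?p ?Z (of_int m0)"
  have prime: "prime ?p" by (rule prime_card)
  have p0: "?p > 0" by simp
  have Z: "?Z = monom 1 u ^ ?p ^ t" by (simp add: monom_power)
  have monic: "monic (?G i)" for i using monic_tower_factor u p0 by simp
  have "int ?p dvd m0 ^ ?p ^ s - m"
    using m0 N by (metis dvd_trans dvd_power add_2_eq_Suc' zero_less_Suc less_le_trans)
  from dvd_diff[OF this prime_dvd_power_prime_power_diff[OF prime, of m0 s]]
  have m0_m: "int ?p dvd m0 - m" by simp
  have m0_ndvd: "\<not> int ?p dvd m0"
  proof
    assume "int ?p dvd m0"
    from dvd_diff[OF this m0_m] show False using um(2) by simp
  qed
  have mt: "int ?p dvd m ^ ?p ^ t - m0"
    using dvd_diff[OF prime_dvd_power_prime_power_diff[OF prime, of m t] m0_m] by (simp add: algebra_simps)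
  have X: "monom 1 u - of_int m \<in> ?M" using \<phi> by (simp add: in_reduction_ideal_iff hom_distribs)
  have Z_m0: "?Z - of_int m0 \<in> ?M"
  proof -
    have "(monom 1 u - of_int m :: 'p mod_ring poly) dvd monom 1 u ^ ?p ^ t - of_int m ^ ?p ^ t"
      by (metis dvd_triv_left power_diff_sumr2)
    with \<phi> have "\<phi> dvd monom 1 u ^ ?p ^ t - of_int m ^ ?p ^ t" by (rule dvd_trans)
    moreover have "\<phi> dvd of_int (m ^ ?p ^ t - m0)" using mt reduce_irreducible_dvd_const[OF irr(1)] by blast
    ultimately have "\<phi> dvd (monom 1 u ^ ?p ^ t - of_int m ^ ?p ^ t) + of_int (m ^ ?p ^ t - m0)"
      by (rule dvd_add)
    thus ?thesis unfolding Z by (simp add: in_reduction_ideal_iff hom_distribs)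
  qed
  show ?thesis
  proof (cases i)
    case 0
    hence G0: "?G i = ?Z - of_int m0" by (simp add: tower_factor_def)
    show ?thesis
    proof (cases "t = 0")
      case True
      hence "?G i = monom 1 u - of_int m0" using G0 by simp
      moreover have "regular_at \<phi> (monom 1 u - of_int m0)"
        using regular_at_separable[OF irr(1) u um(1) m0_ndvd] Z_m0 True by simp
      ultimately show ?thesis by simp
    next
      case False
      have "\<not> int ?p ^ 2 dvd m ^ ?p ^ t - m0"
        using False t by (intro root_not_congruent_mod_square[OF prime um(2) _ N m0]) auto
      thus ?thesis
        using regular_at_binomial[OF irr _ X monic[of i] _ mt] False G0 Z by simp
    qed
  next
    case (Suc j)
    have "?Z - of_int m0 dvd ?Z ^ ?p ^ j - of_int m0 ^ ?p ^ j"
      by (metis dvd_triv_left power_diff_sumr2)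
    then obtain q where "?Z ^ ?p ^ j - of_int m0 ^ ?p ^ j = (?Z - of_int m0) * q" by (elim dvdE)
    hence W: "?Z ^ ?p ^ j - of_int (m0 ^ ?p ^ j) \<in> ?M"
      using Z_m0 by (simp add: in_reduction_ideal_iff hom_distribs)
    have "\<not> int ?p dvd m0 ^ ?p ^ j"
      using m0_ndvd prime_card_int[where 'a='p] prime_dvd_power by blast
    from regular_at_cyclotomic[OF irr odd this W monic[of i]] show ?thesis
      by (simp add: tower_factor_def Suc)
  qed
qed

text \<open>With e the upper product and P = p^(s-j), the element e * (e - P * m_0^K) is a multiple
  of the full product, whose value at \<alpha> is divisible by \<open>p ^ N\<close>. Dividing by P^2
  leaves a monic quadratic for e/P over Z[\<alpha>].\<close>

lemma algebraic_int_separator: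
  fixes \<alpha> :: complex and m m0 :: int
  assumes n: "n > 0" "\<alpha> ^ n = of_int m" and p: "p > 0" and k: "n = k * p ^ s"
    and N: "N \<ge> 2 * s" "int p ^ N dvd m0 ^ p ^ s - m" and j: "j \<le> s"
  shows "algebraic_int (poly (map_poly of_int
    (\<Prod>l\<in>{j<..s}. tower_factor p (monom 1 k) (of_int m0) l)) \<alpha> / of_nat p ^ (s - j))"
proof -
  let ?G = "tower_factor p (monom 1 k) (of_int m0) :: nat \<Rightarrow> int poly"
  let ?ev = "\<lambda>f. poly (map_poly of_int f) \<alpha>"
  define e where "e = (\<Prod>l\<in>{j<..s}. ?G l)"
  obtain K where "(\<Prod>i\<le>j. ?G i) dvd e - of_nat p ^ (s - j) * of_int m0 ^ K"
    using prod_upper_tower_factor_cong[OF p, where Z="monom 1 k" and w="of_int m0"] unfolding e_def by blast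
  then obtain h where h: "e - of_nat p ^ (s - j) * of_int m0 ^ K = (\<Prod>i\<le>j. ?G i) * h" by (elim dvdE)
  have "{..s} = {..j} \<union> {j<..s}" using j by auto
  hence "(\<Prod>i\<le>s. ?G i) = (\<Prod>i\<le>j. ?G i) * e"
    unfolding e_def by (simp add: prod.union_disjoint ivl_disj_int)
  hence Gt: "(\<Prod>i\<le>j. ?G i) * e = monom 1 n - of_int (m0 ^ p ^ s)"
    by (simp add: prod_tower_factor monom_power k)
  obtain \<kappa> where \<kappa>: "m0 ^ p ^ s - m = int p ^ N * \<kappa>" using N(2) by (elim dvdE)
  have ev_Gt: "?ev ((\<Prod>i\<le>j. ?G i) * e) = - (of_nat p ^ N * of_int \<kappa>)"
  proof -
    have "?ev ((\<Prod>i\<le>j. ?G i) * e) = of_int (m - m0 ^ p ^ s)"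
      unfolding Gt using n(2) by (simp add: hom_distribs poly_monom)
    also have "m - m0 ^ p ^ s = - (int p ^ N * \<kappa>)" using \<kappa> by simp
    finally show ?thesis by simp
  qed
  define P where "P = (of_nat p :: complex) ^ (s - j)"
  have P0: "P \<noteq> 0" using p by (simp add: P_def)
  \<comment> \<open>The bound N >= 2 * s is exactly what lets P^2 split off.\<close>
  have PN: "of_nat p ^ N = P ^ 2 * of_nat p ^ (N - 2 * (s - j))"
    unfolding P_def power_mult[symmetric] using N(1) by (simp flip: power_add)
  have "e * (e - of_nat p ^ (s - j) * of_int m0 ^ K) = ((\<Prod>i\<le>j. ?G i) * e) * h"
    unfolding h by (simp add: algebra_simps)
  hence "?ev (e * (e - of_nat p ^ (s - j) * of_int m0 ^ K)) = ?ev ((\<Prod>i\<le>j. ?G i) * e) * ?ev h"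
    by (simp only: of_int_poly_hom.hom_mult poly_mult)
  hence "?ev e * (?ev e - P * of_int (m0 ^ K)) =
      P ^ 2 * ?ev (of_int (- (int p ^ (N - 2 * (s - j)) * \<kappa>)) * h)"
    unfolding ev_Gt PN by (simp add: hom_distribs P_def)
  moreover have "(x / P) ^ 2 = M * (x / P) + y" if "x * (x - P * M) = P ^ 2 * y" for x y M
  proof -
    have "(x / P) ^ 2 - M * (x / P) = x * (x - P * M) / P ^ 2"
      using P0 by (simp add: power2_eq_square diff_divide_distrib right_diff_distrib)
    thus ?thesis unfolding that using P0 by (simp add: algebra_simps)
  qed
  ultimately have "(?ev e / P) ^ 2 = of_int (m0 ^ K) * (?ev e / P)
      + ?ev (of_int (- (int p ^ (N - 2 * (s - j)) * \<kappa>)) * h)" by blast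
  from algebraic_int_quadratic[OF n this] show ?thesis unfolding e_def P_def .
qed

section \<open>The counting bound\<close>

lemma factor_count_bound:
  fixes n u r s d :: nat and m :: int and \<alpha> :: complex
  assumes odd: "odd CARD('p::prime_card)" and u: "u > 0"
    and um: "\<not> int CARD('p) dvd int u" "\<not> int CARD('p) dvd m"
    and n: "n = u * CARD('p) ^ r" and s: "s \<le> r"
    and \<nu>: "int CARD('p) ^ (s + 1) dvd m ^ (CARD('p) - 1) - 1"
      "s = r \<or> \<not> int CARD('p) ^ (s + 2) dvd m ^ (CARD('p) - 1) - 1"
    and irr: "irreducible (monom (1::rat) n - [:of_int m:])"
    and \<alpha>: "\<alpha> ^ n = of_int m" and mono: "monogenic (num_field \<alpha>)"
  shows "(s + 1) * N_fac TYPE('p) d u m \<le> N_irr TYPE('p) d"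
proof -
  let ?p = "CARD('p)"
  let ?ev = "\<lambda>f. poly (map_poly of_int f) \<alpha>"
  have prime: "prime ?p" by (rule prime_card)
  have p0: "?p > 0" by simp
  have n0: "n > 0" using u by (simp add: n)
  define R where "R = ring_of_ints (num_field \<alpha>)"
  obtain \<theta> k where \<theta>: "\<theta> \<in> R" and basis:
    "\<forall>x\<in>R. \<exists>!c::nat \<Rightarrow> int. (\<forall>i\<ge>k. c i = 0) \<and> x = (\<Sum>i<k. of_int (c i) * \<theta> ^ i)"
    using mono unfolding monogenic_def R_def by blast
  obtain L b where Lb: "L > 0" "of_int L * \<theta> = ?ev b"
    using \<theta> num_field_clear_denominator unfolding R_def ring_of_ints_def by blast
  have "L \<noteq> 0" "\<not> int ?p dvd 1" using Lb(1) prime by auto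
  then obtain D where D: "L = int ?p ^ multiplicity (int ?p) L * D" "\<not> int ?p dvd D"
    by (rule multiplicity_decompose')
  define c where "c = multiplicity (int ?p) L"
  obtain T where T: "monic T" "poly (map_poly of_int T) \<theta> = 0"
    using \<theta> unfolding R_def ring_of_ints_def algebraic_int_altdef_ipoly by auto
  \<comment> \<open>The summands pay for the integral equation of \<theta>
    (\<open>c * degree T\<close>), the comparison of residues (\<open>c * k\<close> and s), the
    integrality of the separators (2 * s), and the bound s + 2 in the regularity of the first
    factor.\<close>
  define N where "N = c * degree T + c * k + 2 * s + 2"
  obtain m0 where m0: "int ?p ^ N dvd m0 ^ ?p ^ s - m"
    using exists_prime_power_root_mod[OF odd prime \<nu>(1)] by blast
  define t where "t = r - s"
  define Z where "Z = (monom 1 (u * ?p ^ t) :: int poly)"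
  define G where "G = tower_factor ?p Z (of_int m0)"
  define F where "F = (monom 1 n - of_int m :: int poly)"
  define e where "e j = (\<Prod>l\<in>{j<..s}. G l)" for j
  have n_t: "n = (u * ?p ^ t) * ?p ^ s" using s by (simp add: n t_def flip: power_add mult.assoc)
  have root: "F dvd P" if "?ev P = 0" for P
  proof (rule dvd_of_common_root[OF _ _ _ that])
    show "irreducible (map_poly of_int F :: rat poly)"
      using irr by (simp add: F_def hom_distribs of_int_poly)
    show "monic F" unfolding F_def using n0 by (rule monic_monom_diff)
    show "?ev F = 0" using \<alpha> by (simp add: F_def hom_distribs poly_monom)
  qed
  have approx: "of_nat ?p ^ N dvd F - (\<Prod>i\<le>s. G i)"
  proof -
    have "F - (\<Prod>i\<le>s. G i) = of_int (m0 ^ ?p ^ s - m)"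
      by (simp add: F_def G_def Z_def prod_tower_factor monom_power n_t)
    moreover obtain q where "m0 ^ ?p ^ s - m = int ?p ^ N * q" using m0 by (elim dvdE)
    ultimately show ?thesis by simp
  qed
  have m0_ndvd: "\<not> int ?p dvd m0"
  proof
    assume "int ?p dvd m0"
    hence "int ?p dvd m0 ^ ?p ^ s" using p0 by (meson dvd_power dvd_trans zero_less_power)
    moreover have "int ?p dvd m0 ^ ?p ^ s - m"
      using m0 by (rule dvd_trans[rotated]) (simp add: N_def)
    ultimately have "int ?p dvd m0 ^ ?p ^ s - (m0 ^ ?p ^ s - m)" by (rule dvd_diff)
    thus False using um(2) by simp
  qed
  have "\<alpha> \<in> R"
  proof -
    have "algebraic_int \<alpha>"
      using monic_monom_diff[OF n0, of m] \<alpha>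
      by (auto simp: algebraic_int_altdef_ipoly hom_distribs poly_monom intro!: exI[of _ "monom 1 n - of_int m"])
    moreover have "\<alpha> \<in> num_field \<alpha>" using poly_of_int_in_num_field[of "[:0, 1:]" \<alpha> 1] by simp
    ultimately show ?thesis by (simp add: R_def ring_of_ints_def)
  qed
  then obtain a where a: "\<forall>i\<ge>k. coeff a i = 0" "poly (map_poly of_int a) \<theta> = \<alpha>"
    using monogenic_obtain_poly[OF basis] by blast
  have "\<exists>f. (\<forall>i\<ge>k. coeff f i = 0) \<and> poly (map_poly of_int f) \<theta> = ?ev (e j) / of_nat ?p ^ (s - j)"
    if "j \<le> s" for j
  proof -
    have "algebraic_int (?ev (e j) / of_nat ?p ^ (s - j))"
      unfolding e_def G_def Z_def
      using algebraic_int_separator[OF n0 \<alpha> p0 n_t _ m0 that] by (simp add: N_def)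
    moreover have "?ev (e j) / of_nat ?p ^ (s - j) \<in> num_field \<alpha>"
      using poly_of_int_in_num_field[of "e j" \<alpha> "int ?p ^ (s - j)"] by simp
    ultimately have "?ev (e j) / of_nat ?p ^ (s - j) \<in> R" by (simp add: R_def ring_of_ints_def)
    thus ?thesis using monogenic_obtain_poly[OF basis] by metis
  qed
  then obtain \<epsilon> where \<epsilon>: "\<And>j. j \<le> s \<Longrightarrow> \<forall>i\<ge>k. coeff (\<epsilon> j) i = 0"
    "\<And>j. j \<le> s \<Longrightarrow> poly (map_poly of_int (\<epsilon> j)) \<theta> = ?ev (e j) / of_nat ?p ^ (s - j)" by metis
  define \<F> where "\<F> = {f :: 'p mod_ring poly. monic f \<and> irreducible f \<and> degree f = d \<and>
    f dvd (monom 1 u - [:of_int m:])}"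
  define \<I> where "\<I> = {f :: 'p mod_ring poly. monic f \<and> irreducible f \<and> degree f = d}"
  \<comment> \<open>Says that g is the minimal polynomial of the residue \<tau> of \<theta>, and
    records the two data that recover the pair from g: \<open>a\<close> sends \<tau> to the residue
    x of \<alpha>, and the j-th separator vanishes exactly for j < i.\<close>
  define Q where "Q \<phi> i g \<tau> \<longleftrightarrow> g \<in> \<I> \<and> (\<forall>w. g dvd w \<longleftrightarrow> \<phi> dvd w \<circ>\<^sub>p \<tau>)
      \<and> \<phi> dvd reduce a \<circ>\<^sub>p \<tau> - [:0, 1:] \<and> (\<forall>j\<le>s. \<phi> dvd reduce (\<epsilon> j) \<circ>\<^sub>p \<tau> \<longleftrightarrow> j < i)" for \<phi> i g \<tau>
  have "\<exists>g \<tau>. Q \<phi> i g \<tau>" if i: "i \<le> s" and \<phi>: "\<phi> \<in> \<F>" for i \<phi>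
  proof -
    have \<phi>': "irreducible \<phi>" "monic \<phi>" "degree \<phi> = d" "\<phi> dvd monom 1 u - of_int m"
      using \<phi> by (auto simp: \<F>_def of_int_poly)
    have reg: "regular_at \<phi> (G i)"
      unfolding G_def Z_def
      by (rule regular_at_tower_factor[OF \<phi>'(1,2) odd u um \<phi>'(4) _ m0])
        (use \<nu>(2) in \<open>auto simp: N_def t_def\<close>)
    have G_dvd: "G i dvd (\<Prod>i\<le>s. G i)" using i by (intro dvd_prodI) auto
    have N: "c * degree T \<le> N" "c * k + s < N" by (auto simp: N_def)
    obtain \<tau> where \<tau>: "\<And>f l g \<gamma>. l \<le> s \<Longrightarrow> \<forall>i\<ge>k. coeff f i = 0 \<Longrightarrow>
        of_nat ?p ^ l * poly (map_poly of_int f) \<theta> = ?ev g \<Longrightarrow>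
        G i dvd g - of_nat ?p ^ l * \<gamma> \<Longrightarrow> f \<circ>\<^sub>p \<tau> - \<gamma> \<in> reduction_ideal \<phi>"
      using exists_residue[OF \<phi>'(1) reg root approx G_dvd D(1)[folded c_def] D(2) Lb(2) T N] by blast
    have red: "reduce (f \<circ>\<^sub>p \<tau>) = (reduce f \<circ>\<^sub>p reduce \<tau> :: 'p mod_ring poly)" for f
      by (simp add: hom_distribs)
    have "a \<circ>\<^sub>p \<tau> - [:0, 1:] \<in> reduction_ideal \<phi>"
      using \<tau>[of 0 a "[:0, 1:]" "[:0, 1:]"] a by simp
    hence ra: "\<phi> dvd reduce a \<circ>\<^sub>p reduce \<tau> - [:0, 1:]"
      by (simp add: in_reduction_ideal_iff hom_distribs)
    have "\<phi> dvd reduce (\<epsilon> j) \<circ>\<^sub>p reduce \<tau> \<longleftrightarrow> j < i" if j: "j \<le> s" for j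
    proof (cases "j < i")
      case True
      have "G i dvd e j" unfolding e_def using True i by (intro dvd_prodI) auto
      hence "\<epsilon> j \<circ>\<^sub>p \<tau> - 0 \<in> reduction_ideal \<phi>"
        using \<epsilon>[OF j] p0 by (intro \<tau>[of "s - j" _ "e j"]) auto
      thus ?thesis using True by (simp add: in_reduction_ideal_iff red)
    next
      case False
      \<comment> \<open>For i <= j the separator is a power of m_0 at this place, hence nonzero as p
        does not divide m_0.\<close>
      obtain K where "(\<Prod>i\<le>j. G i) dvd e j - of_nat ?p ^ (s - j) * of_int m0 ^ K"
        using prod_upper_tower_factor_cong[OF p0, where Z=Z and w="of_int m0"]
        unfolding e_def G_def by blast
      moreover have "G i dvd (\<Prod>i\<le>j. G i)" using False by (intro dvd_prodI) auto
      ultimately have "G i dvd e j - of_nat ?p ^ (s - j) * of_int m0 ^ K" by (rule dvd_trans[rotated])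
      hence "\<epsilon> j \<circ>\<^sub>p \<tau> - of_int m0 ^ K \<in> reduction_ideal \<phi>"
        using \<epsilon>[OF j] p0 by (intro \<tau>[of "s - j" _ "e j"]) auto
      hence 1: "\<phi> dvd reduce (\<epsilon> j) \<circ>\<^sub>p reduce \<tau> - of_int (m0 ^ K)"
        by (simp add: in_reduction_ideal_iff hom_distribs)
      have "\<not> \<phi> dvd reduce (\<epsilon> j) \<circ>\<^sub>p reduce \<tau>"
      proof
        assume "\<phi> dvd reduce (\<epsilon> j) \<circ>\<^sub>p reduce \<tau>"
        from dvd_diff[OF this 1] have "\<phi> dvd of_int (m0 ^ K)" by simp
        hence "int ?p dvd m0 ^ K" using reduce_irreducible_dvd_const[OF \<phi>'(1)] by blast
        thus False using m0_ndvd prime_card_int[where 'a='p] prime_dvd_power by blast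
      qed
      thus ?thesis using False by simp
    qed
    moreover obtain g where "monic g \<and> irreducible g \<and> degree g = degree \<phi>
        \<and> (\<forall>w. g dvd w \<longleftrightarrow> \<phi> dvd w \<circ>\<^sub>p reduce \<tau>)"
      using exists_residue_min_poly[OF \<phi>'(1) ra] by blast
    ultimately show ?thesis using ra \<phi>'(3) unfolding Q_def \<I>_def by blast
  qed
  then obtain g \<tau> where "\<And>i \<phi>. i \<le> s \<Longrightarrow> \<phi> \<in> \<F> \<Longrightarrow> Q \<phi> i (g i \<phi>) (\<tau> i \<phi>)" by metis
  hence g: "\<And>\<phi> i. \<phi> \<in> \<F> \<Longrightarrow> i \<le> s \<Longrightarrow> g i \<phi> \<in> \<I>"
    "\<And>\<phi> i w. \<phi> \<in> \<F> \<Longrightarrow> i \<le> s \<Longrightarrow> g i \<phi> dvd w \<longleftrightarrow> \<phi> dvd w \<circ>\<^sub>p \<tau> i \<phi>"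
    "\<And>\<phi> i. \<phi> \<in> \<F> \<Longrightarrow> i \<le> s \<Longrightarrow> \<phi> dvd reduce a \<circ>\<^sub>p \<tau> i \<phi> - [:0, 1:]"
    "\<And>\<phi> i j. \<phi> \<in> \<F> \<Longrightarrow> i \<le> s \<Longrightarrow> j \<le> s \<Longrightarrow> \<phi> dvd reduce (\<epsilon> j) \<circ>\<^sub>p \<tau> i \<phi> \<longleftrightarrow> j < i"
    unfolding Q_def by blast+
  have g_inj: "i \<le> i' \<and> \<phi> = \<phi>'"
    if A: "\<phi> \<in> \<F>" "i \<le> s" "\<phi>' \<in> \<F>" "i' \<le> s" "g i \<phi> = g i' \<phi>'" for i i' \<phi> \<phi>'
  proof -
    \<comment> \<open>Since a(\<tau>) = x modulo f, composing with \<open>a\<close> turns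
      divisibility by g back into divisibility by the original factor; this recovers \<phi> from
      g.\<close>
    have a_comp: "f dvd w \<circ>\<^sub>p reduce a \<circ>\<^sub>p \<tau> l f \<longleftrightarrow> f dvd w" if "f \<in> \<F>" "l \<le> s" for f w l
    proof -
      have "f dvd w \<circ>\<^sub>p (reduce a \<circ>\<^sub>p \<tau> l f) - w \<circ>\<^sub>p [:0, 1:]"
        using g(3)[OF that] diff_dvd_pcompose_diff dvd_trans by blast
      hence "f dvd w \<circ>\<^sub>p reduce a \<circ>\<^sub>p \<tau> l f - w" by (simp add: pcompose_assoc)
      thus ?thesis by (metis dvd_diff_right_iff dvd_add_right_iff diff_add_cancel)
    qed
    have "g i \<phi> dvd \<phi> \<circ>\<^sub>p reduce a" using g(2)[OF A(1,2)] a_comp[OF A(1,2)] by simp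
    hence "\<phi>' dvd \<phi>" using g(2)[OF A(3,4)] a_comp[OF A(3,4)] A(5) by simp
    moreover have "\<phi> \<noteq> 0" "degree \<phi> = degree \<phi>'" "monic \<phi>" "monic \<phi>'"
      using A(1,3) by (auto simp: \<F>_def)
    ultimately have "\<phi> = \<phi>'"
    proof -
      obtain q where q: "\<phi> = \<phi>' * q" using \<open>\<phi>' dvd \<phi>\<close> by (elim dvdE)
      have "\<phi>' \<noteq> 0" "q \<noteq> 0" using q \<open>\<phi> \<noteq> 0\<close> by auto
      hence "degree q = 0" using q \<open>degree \<phi> = degree \<phi>'\<close> by (simp add: degree_mult_eq)
      moreover have "monic q" using q \<open>monic \<phi>\<close> \<open>monic \<phi>'\<close> by (simp add: lead_coeff_mult)
      ultimately have "q = 1" by (simp add: monic_degree_0)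
      thus ?thesis using q by simp
    qed
    \<comment> \<open>If i' < i, the separator with index i' vanishes at the place of i but not at
      that of i'. One inequality suffices, as the roles are exchanged afterwards.\<close>
    moreover have "i \<le> i'"
    proof (rule ccontr)
      assume "\<not> i \<le> i'"
      hence "g i \<phi> dvd reduce (\<epsilon> i')" unfolding g(2)[OF A(1,2)] g(4)[OF A(1,2,4)] by simp
      thus False unfolding A(5) g(2)[OF A(3,4)] g(4)[OF A(3,4,4)] by simp
    qed
    ultimately show ?thesis by blast
  qed
  have "inj_on (\<lambda>(i, \<phi>). g i \<phi>) ({..s} \<times> \<F>)"
  proof (rule inj_onI)
    fix x y
    assume "x \<in> {..s} \<times> \<F>" "y \<in> {..s} \<times> \<F>" "(case x of (i, \<phi>) \<Rightarrow> g i \<phi>) = (case y of (i, \<phi>) \<Rightarrow> g i \<phi>)"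
    thus "x = y"
      using g_inj[of "snd x" "fst x" "snd y" "fst y"] g_inj[of "snd y" "fst y" "snd x" "fst x"]
      by (auto simp: case_prod_beta prod_eq_iff)
  qed
  moreover have "(\<lambda>(i, \<phi>). g i \<phi>) ` ({..s} \<times> \<F>) \<subseteq> \<I>" using g(1) by auto
  moreover have "finite \<I>"
    by (rule finite_subset[OF _ finite_degree_less[of "Suc d"]]) (auto simp: \<I>_def)
  ultimately have "card ({..s} \<times> \<F>) \<le> card \<I>" by (rule card_inj_on_le)
  thus ?thesis by (simp add: N_fac_def N_irr_def \<F>_def \<I>_def card_cartesian_product)
qed

theorem theorem2p1:
  fixes n u r d :: nat and m :: int and p :: nat and \<alpha> :: complex
  assumes "n \<ge> 3"
    and "m \<noteq> 0" and "m \<noteq> 1" and "m \<noteq> -1"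
    and "irreducible (Polynomial.monom (1::rat) n - [:of_int m:])"
    and "\<alpha> ^ n = of_int m"
    and "u > 0" and "n = u * p ^ r"
    and "prime p" and "odd p" and "\<not> int p dvd int u * m"
    and "CARD('p::prime_card) = p"
    and "d > 0"
    and "min (r + 1) (multiplicity (int p) (m ^ (p - 1) - 1)) * N_fac TYPE('p) d u m
           > N_irr TYPE('p) d"
  shows "\<not> monogenic (num_field \<alpha>)"
proof
  assume mono: "monogenic (num_field \<alpha>)"
  define \<nu> where "\<nu> = multiplicity (int p) (m ^ (p - 1) - 1)"
  \<comment> \<open>The truncated subtraction is harmless: Fermat gives \<nu> >= 1 below.\<close>
  define s where "s = min r (\<nu> - 1)"
  have um: "\<not> int p dvd int u" "\<not> int p dvd m" using assms(11) by (auto simp del: of_nat_dvd_iff)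
  have p1: "p - 1 > 0" using prime_gt_1_nat[OF assms(9)] by simp
  \<comment> \<open>The multiplicity of 0 is 0 by convention, so this must be excluded before \<nu>
    can be read as a valuation.\<close>
  have "m ^ (p - 1) - 1 \<noteq> 0"
  proof
    assume "m ^ (p - 1) - 1 = 0"
    hence "\<bar>m\<bar> ^ (p - 1) = 1" by (simp flip: power_abs)
    hence "\<bar>m\<bar> dvd 1" using p1 by (metis dvd_power)
    thus False using assms(3,4) by auto
  qed
  hence dvd_iff: "int p ^ j dvd m ^ (p - 1) - 1 \<longleftrightarrow> j \<le> \<nu>" for j
    unfolding \<nu>_def using assms(9) by (intro power_dvd_iff_le_multiplicity) auto
  have "\<nu> \<ge> 1"
    using prime_dvd_power_minus_one[OF assms(9) um(2)] dvd_iff[of 1] by simp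
  hence s: "s + 1 = min (r + 1) \<nu>" "s \<le> r" by (auto simp: s_def)
  have "(s + 1) * N_fac TYPE('p) d u m \<le> N_irr TYPE('p) d"
  proof (rule factor_count_bound[where 'p='p and n=n and r=r and \<alpha>=\<alpha>, unfolded assms(12)])
    show "int p ^ (s + 1) dvd m ^ (p - 1) - 1" using s(1) unfolding dvd_iff by simp
    show "s = r \<or> \<not> int p ^ (s + 2) dvd m ^ (p - 1) - 1" using s(1) unfolding dvd_iff by linarith
  qed (use assms um s mono in auto)
  thus False using assms(14) unfolding \<nu>_def[symmetric] s(1)[symmetric] by linarith
qed

end
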